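(* Assume the setting and Assumptions 1–5 described in the context, and suppose $\theta>r_B$. Then there exists $\varepsilon_0>0$ such that, as $k\to\infty$, \[ \bar x(k)=\frac{k^{m_B-1}}{(m_B-1)!}\,\frac{1}{r_B^k}\,\xi(k)+\begin{cases}O\big((r_B+\varepsilon_0)^{-k}\big)e^{\rm t},& m_B=1,\\ O\big(k^{m_B-2}r_B^{-k}\big)e^{\rm t},& m_B\ge2,\end{cases} \] where \[ \xi(k)=\sum_{n=0}^{N-1}\frac{1}{\zeta_n^k}\,\frac{x(0)\tilde B(r_B\zeta_n)}{r_B\zeta_n-1}\big[I-\Gamma_A^*(r_B\zeta_n)\big]^{-1}. \] Further, $\limsup_{k\to\infty}\xi(k)>0$ (componentwise) and $\xi(k)\ge0$ for all $k=0,1,\dots$.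
   Context: Let $M_0,M$ be positive integers. Consider a discrete-time Markov chain of M/G/1 type with state space $\{(0,j):1\le j\le M_0\}\cup\{(k,j):k\ge1,1\le j\le M\}$ (states with first coordinate $k$ form level $k$), with transition matrix in lexicographic order \[ T=\begin{pmatrix}B(0)&B(1)&B(2)&\cdots\\ C(0)&A(1)&A(2)&\cdots\\ O&A(0)&A(1)&\cdots\\ O&O&A(0)&\cdots\\ \vdots&\vdots&\vdots&\ddots\end{pmatrix}, \] where $A(k)$ ($k\ge0$) are nonnegative $M\times M$, $B(0)$ is $M_0\times M_0$, $B(k)$ ($k\ge1$) are $M_0\times M$, $C(0)$ is $M\times M_0$, all nonnegative; $A=\sum_{k\ge0}A(k)$ is stochastic, $B(0)e+\sum_{k\ge1}B(k)e=e$ ($e$ a column of ones), $\pi A=\pi$, $\pi e=1$. Let $A^*(z)=\sum_{k\ge0}z^kA(k)$, $B^*(z)=\sum_{k\ge1}z^kB(k)$ with convergence radii $r_A,r_B$, and $\Gamma_A^*(z)=z^{-1}A^*(z)$. For a square complex matrix $X$, $\delta(X)$ is a maximum-modulus eigenvalue with nonnegative argument and maximal real part among maximum-modulus eigenvalues (the Perron–Frobenius eigenvalue for nonnegative irreducible $X$). Assumption 1: (a) $T$ irreducible; (b) $A$ irreducible; (c) $\pi\sum_{k\ge1}kA(k)e<1$; (d) $\sum_{k\ge1}kB(k)e$ finite. Assumption 2: $r_A>1$, $r_B>1$. Assumption 3: there is a finite $\theta$ with $1<\theta<r_A$ and $\theta=\delta(A^*(\theta))$. Assumption 4: $B^*(z)$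 is meromorphic in an open set containing $\{z:|z|\le r_B\}$, and there exist a positive integer $m_B$ and a finite nonnegative matrix $\tilde B(r_B)\neq O$ with $\lim_{z\to r_B}(1-z/r_B)^{m_B}B^*(z)=\tilde B(r_B)$. Assumption 5: there exist exactly $N\ge1$ complex numbers $\zeta_0,\dots,\zeta_{N-1}$ with $|\zeta_n|=1$, $0=\arg\zeta_0<\arg\zeta_1<\cdots<\arg\zeta_{N-1}<2\pi$, such that $\lim_{z\to r_B\zeta_n}(1-z/(r_B\zeta_n))^{m_B}B^*(z)=\tilde B(r_B\zeta_n)$ is a finite nonzero matrix. $x=(x(0),x(1),\dots)$ is the stationary probability vector partitioned by levels, $\bar x(k)=\sum_{l\ge k+1}x(l)$; $O(g(k))e^{\rm t}$ denotes a row vector with entries $O(g(k))$. *)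

theory Defs
  imports "HOL-Complex_Analysis.Complex_Analysis" "HOL-Library.Landau_Symbols"
begin

no_notation fps_nth (infixl \<open>$\<close> 75)

text \<open>States of the M/G/1-type chain: L0 j is state (0,j), Lk k j is state (k,j), k >= 1.
  Phases of level 0 range over a finite type 'p (M0 = CARD('p)),
  phases of levels k >= 1 over a finite type 'm (M = CARD('m)).\<close>
datatype ('p, 'm) mg1_state = L0 'p | Lk nat 'm

definition mg1_states :: "('p, 'm) mg1_state set" where
  "mg1_states = range L0 \<union> {Lk k j | k j. 1 \<le> k}"

text \<open>The transition matrix T in block form.  B is indexed by k >= 1 (B 0 unused),
  B0 is B(0), C0 is C(0).\<close>
fun mg1_T :: "(nat \<Rightarrow> real^'m^'m) \<Rightarrow> real^'p^'p \<Rightarrow> (nat \<Rightarrow> real^'m^'p) \<Rightarrow> real^'p^'m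
   \<Rightarrow> ('p, 'm) mg1_state \<Rightarrow> ('p, 'm) mg1_state \<Rightarrow> real" where
  "mg1_T A B0 B C0 (L0 i) (L0 j) = B0 $ i $ j"
| "mg1_T A B0 B C0 (L0 i) (Lk l j) = B l $ i $ j"
| "mg1_T A B0 B C0 (Lk k i) (L0 j) = (if k = 1 then C0 $ i $ j else 0)"
| "mg1_T A B0 B C0 (Lk k i) (Lk l j) = (if k \<le> l + 1 then A (l + 1 - k) $ i $ j else 0)"

text \<open>Irreducibility of a (possibly infinite) nonnegative matrix on a state set S.\<close>
definition irreducible_on :: "'s set \<Rightarrow> ('s \<Rightarrow> 's \<Rightarrow> real) \<Rightarrow> bool" where
  "irreducible_on S P \<longleftrightarrow>
     (\<forall>s\<in>S. \<forall>t\<in>S. (s, t) \<in> {(u, v). u \<in> S \<and> v \<in> S \<and> P u v > 0}\<^sup>*)"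

text \<open>Eigenvalues of a complex square matrix, and delta(X).\<close>
definition is_eigenvalue :: "complex^'n^'n \<Rightarrow> complex \<Rightarrow> bool" where
  "is_eigenvalue X l \<longleftrightarrow> (\<exists>v. v \<noteq> 0 \<and> X *v v = l *s v)"

definition delta :: "complex^'n^'n \<Rightarrow> complex" where
  "delta X = (THE l. is_eigenvalue X l
      \<and> (\<forall>\<mu>. is_eigenvalue X \<mu> \<longrightarrow> cmod \<mu> \<le> cmod l)
      \<and> 0 \<le> Arg l
      \<and> (\<forall>\<mu>. is_eigenvalue X \<mu> \<and> cmod \<mu> = cmod l \<longrightarrow> Re \<mu> \<le> Re l))"

text \<open>Generating functions A*(z) = sum_{k>=0} z^k A(k), B*(z) = sum_{k>=1} z^k B(k),
  Gamma_A*(z) = z^{-1} A*(z).\<close>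
definition Astar :: "(nat \<Rightarrow> real^'m^'n) \<Rightarrow> complex \<Rightarrow> complex^'m^'n" where
  "Astar A z = (\<chi> i j. \<Sum>k. z ^ k * complex_of_real (A k $ i $ j))"

definition Bstar :: "(nat \<Rightarrow> real^'m^'n) \<Rightarrow> complex \<Rightarrow> complex^'m^'n" where
  "Bstar B z = (\<chi> i j. \<Sum>k. z ^ Suc k * complex_of_real (B (Suc k) $ i $ j))"

definition GammaA :: "(nat \<Rightarrow> real^'m^'m) \<Rightarrow> complex \<Rightarrow> complex^'m^'m" where
  "GammaA A z = (\<chi> i j. Astar A z $ i $ j / z)"

text \<open>Sum of a summable matrix sequence (A = sum_k A(k)).\<close>
definition msum :: "(nat \<Rightarrow> real^'m^'n) \<Rightarrow> real^'m^'n" where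
  "msum A = (\<chi> i j. \<Sum>k. A k $ i $ j)"

end

theory Submission
  imports Defs
begin

text \<open>
  The generating function \<open>X(z) = \<Sum> z\<^sup>k x(k)\<close> satisfies
  \<open>X(z) (z I - A\<^sup>*(z)) = z (x(0) B\<^sup>*(z) - x(1) A(0))\<close> in the unit disc. By Cramer's rule it
  continues meromorphically beyond \<open>|z| = r\<^sub>B\<close>, and on \<open>|z| = 1\<close> it has no poles because it is
  bounded inside the disc. For \<open>1 < |z| < \<theta>\<close> the matrix \<open>z I - A\<^sup>*(z)\<close> is invertible: with
  \<open>|z| = s = \<theta>\<^sup>t\<close> and \<open>u\<close> the Perron vector of \<open>A\<^sup>*(\<theta>)\<close>, weighted AM-GM shows that \<open>v = u\<^sup>t\<close>
  satisfies \<open>A\<^sup>*(s) v \<le> s v\<close>, and equality in every row would force the mean drift to be zero.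
  So the only singularities up to \<open>|z| = r\<^sub>B\<close> come from \<open>B\<^sup>*\<close>, and subtracting the leading polar
  parts of \<open>(X(z) - X(1)) / (z - 1)\<close> gives the asymptotics.

  The limit \<open>\<xi>\<close> is almost periodic, so \<open>\<xi>(k)\<close> is a limit of scaled tails along a sequence of
  return times, whence \<open>\<xi>(k) \<ge> 0\<close>. Its mean value is the term of \<open>\<zeta> = 1\<close>, which is positive by
  irreducibility, and this makes the upper limit positive.
\<close>

subsection \<open>Coefficients of functions with poles on a circle\<close>

text \<open>The determinant of \<open>z I - Astar A z\<close> vanishes at z = 1, because A is
  stochastic, and may vanish elsewhere in the closed unit disc, so the Cramer quotient says nothing
  there by itself. The kernel is not factorized: boundedness of the series excludes poles in the
  closed disc, and invertibility has to be shown only on the open annulus between 1 and theta. The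
  divisor z - 1 comes from summation by parts, which turns level probabilities into tails. The
  hypotheses leave room for singularities of the continuation of \<open>Bstar\<close> on the circle
  outside the given finite set. Nonnegativity of B bounds their order by \<open>mB\<close>, and
  their coefficient at that order is then 0, so they reach only the error term. For
  \<open>mB >= 2\<close> that error collects the lower-order poles and the replacement of a binomial
  coefficient by its leading power of k; for \<open>mB = 1\<close> both are absent and the error is
  exponentially smaller.\<close>

lemma holomorphic_imp_coeff_bigo:
  fixes c :: "nat \<Rightarrow> complex"
  assumes "g has_fps_expansion Abs_fps c" "g holomorphic_on ball 0 R" "0 < r" "r < R"
  shows "(\<lambda>k. cmod (c k)) \<in> O(\<lambda>k. 1 / r ^ k)"
proof -
  have "(\<lambda>n. fps_nth (Abs_fps c) n * complex_of_real r ^ n) sums g (of_real r)"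
    by (rule has_fps_expansion_imp_sums_complex[where r = "ereal R"]) (use assms in auto)
  hence "summable (\<lambda>n. c n * complex_of_real r ^ n)"
    by (auto simp: sums_iff)
  hence "Bseq (\<lambda>n. c n * complex_of_real r ^ n)"
    by (rule summable_imp_Bseq)
  then obtain K where K: "\<And>n. norm (c n * complex_of_real r ^ n) \<le> K"
    by (meson BseqE)
  show ?thesis
  proof (rule bigoI[where c = K], rule always_eventually, rule allI)
    fix n
    have "cmod (c n) * r ^ n \<le> K"
      using K[of n] \<open>0 < r\<close> by (simp add: norm_mult norm_power)
    thus "norm (cmod (c n)) \<le> K * norm (1 / r ^ n)"
      using \<open>0 < r\<close> by (simp add: field_simps)
  qed
qed

lemma has_fps_expansion_pole_term:
  fixes p :: complex
  assumes "p \<noteq> 0"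
  shows "(\<lambda>z. L / (1 - z / p) ^ Suc m) has_fps_expansion
           Abs_fps (\<lambda>k. L * of_nat (k + m choose m) / p ^ k)"
proof -
  have "(\<lambda>z. 1 - (1 / p) * z) has_fps_expansion (1 - fps_const (1 / p) * fps_X)"
    by (intro fps_expansion_intros)
  hence "(\<lambda>z. L * inverse ((1 - (1 / p) * z) ^ Suc m)) has_fps_expansion
           fps_const L * inverse ((1 - fps_const (1 / p) * fps_X) ^ Suc m)"
    by (intro fps_expansion_intros) (auto simp: fps_nth_power_0)
  also have "fps_const L * inverse ((1 - fps_const (1 / p) * fps_X) ^ Suc m) =
             Abs_fps (\<lambda>k. L * of_nat (k + m choose m) / p ^ k)"
    by (subst one_minus_const_fps_X_neg_power', simp, rule fps_ext)
       (simp add: power_divide add.commute[of m] binomial_symmetric[of m])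
  finally show ?thesis
    by (simp add: divide_inverse mult.commute)
qed

text \<open>Removing the singularity leaves an analytic function with value 0 at \<open>p\<close>,
  and the quotient tends to its derivative. This lowers a pole order once the leading term is
  cancelled, and later makes the point 1 removable.\<close>

lemma tendsto_0_imp_tendsto_difference_quotient:
  fixes \<phi> :: "complex \<Rightarrow> complex"
  assumes "isolated_singularity_at \<phi> p" "\<phi> \<midarrow>p\<rightarrow> 0"
  obtains D where "(\<lambda>z. \<phi> z / (z - p)) \<midarrow>p\<rightarrow> D"
proof -
  have "remove_sings \<phi> analytic_on {p}"
    using assms by (rule remove_sings_analytic_at)
  then obtain D where "(remove_sings \<phi> has_field_derivative D) (at p)"
    using analytic_on_imp_differentiable_at field_differentiable_def by blast
  moreover have "remove_sings \<phi> p = 0"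
    using assms(2) by (rule remove_sings_eqI)
  ultimately have "(\<lambda>z. remove_sings \<phi> z / (z - p)) \<midarrow>p\<rightarrow> D"
    by (simp add: has_field_derivative_iff)
  moreover have "eventually (\<lambda>z. remove_sings \<phi> z / (z - p) = \<phi> z / (z - p)) (at p)"
    using eventually_remove_sings_eq_at[OF assms(1)] by eventually_elim simp
  ultimately have "(\<lambda>z. \<phi> z / (z - p)) \<midarrow>p\<rightarrow> D"
    by (rule Lim_transform_eventually)
  thus ?thesis by (rule that)
qed

lemma isolated_singularity_at_finite:
  assumes "g analytic_on S - P" "open S" "finite P" "p \<in> S"
  shows "isolated_singularity_at g p"
proof -
  have "open (S - (P - {p}))"
    using assms by (intro open_Diff finite_imp_closed) auto
  then obtain e where "e > 0" "ball p e \<subseteq> S - (P - {p})"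
    using assms(4) by (metis DiffI DiffD2 insertI1 open_contains_ball)
  moreover from this have "g analytic_on ball p e - {p}"
    by (intro analytic_on_subset[OF assms(1)]) auto
  ultimately show ?thesis
    by (auto simp: isolated_singularity_at_def)
qed

text \<open>Near \<open>p\<close> the terms of the other points are regular, so the factor
  \<open>(1 - z / p) ^ Suc m\<close> kills them and exactly \<open>L p\<close> is cancelled; the
  order drops by one. \<open>L p = 0\<close> is allowed, so \<open>P\<close> may contain weaker
  poles and regular points.\<close>

lemma subtract_leading_poles:
  fixes c :: "nat \<Rightarrow> complex" and L :: "complex \<Rightarrow> complex"
  assumes fps: "g has_fps_expansion Abs_fps c"
    and P: "finite P" "P \<subseteq> sphere 0 \<rho>" "0 < \<rho>" "\<rho> < R"
    and ana: "g analytic_on ball 0 R - P"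
    and lim: "\<And>p. p \<in> P \<Longrightarrow> (\<lambda>z. (1 - z / p) ^ Suc m * g z) \<midarrow>p\<rightarrow> L p"
  shows "\<exists>g' L'.
    g' has_fps_expansion Abs_fps (\<lambda>k. c k - (\<Sum>p\<in>P. L p * of_nat (k + m choose m) / p ^ k)) \<and>
    g' analytic_on ball 0 R - P \<and>
    (\<forall>p\<in>P. (\<lambda>z. (1 - z / p) ^ m * g' z) \<midarrow>p\<rightarrow> L' p)"
proof -
  define h where "h = (\<lambda>z. \<Sum>p\<in>P. L p / (1 - z / p) ^ Suc m)"
  define g' where "g' = (\<lambda>z. g z - h z)"
  have P0: "p \<noteq> 0" if "p \<in> P" for p
    using that P by auto
  have "g' has_fps_expansion Abs_fps c - (\<Sum>p\<in>P. Abs_fps (\<lambda>k. L p * of_nat (k + m choose m) / p ^ k))"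
    unfolding g'_def h_def
    by (intro fps_expansion_intros fps has_fps_expansion_pole_term P0)
  also have "Abs_fps c - (\<Sum>p\<in>P. Abs_fps (\<lambda>k. L p * of_nat (k + m choose m) / p ^ k)) =
      Abs_fps (\<lambda>k. c k - (\<Sum>p\<in>P. L p * of_nat (k + m choose m) / p ^ k))"
    by (rule fps_ext) (simp add: fps_sum_nth)
  finally have 1: "g' has_fps_expansion \<dots>" .
  have 2: "g' analytic_on ball 0 R - P"
    unfolding g'_def h_def
    by (intro analytic_intros ana) (use P0 in \<open>auto simp: field_simps\<close>)
  have "\<exists>l. (\<lambda>z. (1 - z / p) ^ m * g' z) \<midarrow>p\<rightarrow> l" if p: "p \<in> P" for p
  proof -
    define \<phi> where "\<phi> = (\<lambda>z. (1 - z / p) ^ Suc m * g' z)"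
    have pR: "p \<in> ball 0 R" using P p by auto
    have "\<phi> analytic_on ball 0 R - P"
      unfolding \<phi>_def by (intro analytic_intros 2) (use P0 p in auto)
    hence iso: "isolated_singularity_at \<phi> p"
      by (rule isolated_singularity_at_finite) (use P pR in auto)
    have "(\<lambda>z. (1 - z / p) ^ Suc m * (L q / (1 - z / q) ^ Suc m)) \<midarrow>p\<rightarrow> (if q = p then L p else 0)"
      if q: "q \<in> P" for q
    proof (cases "q = p")
      case True
      have "eventually (\<lambda>z. z \<noteq> p) (at p)"
        by (simp add: eventually_at_filter)
      hence "eventually (\<lambda>z. L p = (1 - z / p) ^ Suc m * (L p / (1 - z / p) ^ Suc m)) (at p)"
        by eventually_elim (use P0[OF p] in \<open>auto simp: field_simps\<close>)
      thus ?thesis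
        unfolding True by (auto intro: Lim_transform_eventually)
    next
      case False
      have "(\<lambda>z. (1 - z / p) ^ Suc m * (L q / (1 - z / q) ^ Suc m)) \<midarrow>p\<rightarrow>
              (1 - p / p) ^ Suc m * (L q / (1 - p / q) ^ Suc m)"
        by (intro tendsto_intros) (use P0 p q False in \<open>auto simp: field_simps\<close>)
      thus ?thesis using False P0[OF p] by simp
    qed
    hence "(\<lambda>z. \<Sum>q\<in>P. (1 - z / p) ^ Suc m * (L q / (1 - z / q) ^ Suc m)) \<midarrow>p\<rightarrow>
             (\<Sum>q\<in>P. if q = p then L p else 0)"
      by (intro tendsto_sum)
    also have "(\<Sum>q\<in>P. if q = p then L p else 0) = L p"
      using P(1) p by simp
    finally have "(\<lambda>z. (1 - z / p) ^ Suc m * g z - (1 - z / p) ^ Suc m * h z) \<midarrow>p\<rightarrow> L p - L p"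
      unfolding h_def sum_distrib_left by (intro tendsto_diff lim p)
    hence "\<phi> \<midarrow>p\<rightarrow> 0"
      unfolding \<phi>_def g'_def by (simp only: right_diff_distrib diff_self)
    from tendsto_0_imp_tendsto_difference_quotient[OF iso this]
    obtain D where "(\<lambda>z. \<phi> z / (z - p)) \<midarrow>p\<rightarrow> D" .
    \<comment> \<open>The factor \<open>- p\<close> turns division by \<open>z - p\<close> into
      division by \<open>1 - z / p\<close>.\<close>
    hence "(\<lambda>z. - p * (\<phi> z / (z - p))) \<midarrow>p\<rightarrow> - p * D"
      by (intro tendsto_intros)
    moreover have "eventually (\<lambda>z. z \<noteq> p) (at p)"
      by (simp add: eventually_at_filter)
    hence "eventually (\<lambda>z. - p * (\<phi> z / (z - p)) = (1 - z / p) ^ m * g' z) (at p)"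
    proof eventually_elim
      case (elim z)
      have "- p * (1 - z / p) = z - p" using P0[OF p] by (simp add: field_simps)
      moreover have "- p * \<phi> z = (- p * (1 - z / p)) * ((1 - z / p) ^ m * g' z)"
        by (simp only: \<phi>_def power_Suc mult_ac)
      ultimately have "- p * \<phi> z = (z - p) * ((1 - z / p) ^ m * g' z)"
        by simp
      thus ?case using elim by (simp add: eq_divide_eq mult.commute)
    qed
    ultimately have "(\<lambda>z. (1 - z / p) ^ m * g' z) \<midarrow>p\<rightarrow> - p * D"
      by (rule Lim_transform_eventually)
    thus ?thesis ..
  qed
  hence "\<exists>L'. \<forall>p\<in>P. (\<lambda>z. (1 - z / p) ^ m * g' z) \<midarrow>p\<rightarrow> L' p"
    by (intro bchoice ballI)
  with 1 2 show ?thesis by blast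
qed

text \<open>Once the singularities are removed, the function is holomorphic on the ball of radius
  \<open>R\<close>, so the coefficients decay at any radius below \<open>R\<close>. The midpoint of
  \<rho> and \<open>R\<close> is the source of the exponential gain for simple poles.\<close>

lemma removable_imp_coeff_bigo:
  fixes c :: "nat \<Rightarrow> complex"
  assumes fps: "g has_fps_expansion Abs_fps c"
    and P: "finite P" "P \<subseteq> sphere 0 \<rho>" "0 < \<rho>" "\<rho> < R"
    and ana: "g analytic_on ball 0 R - P"
    and lim: "\<And>p. p \<in> P \<Longrightarrow> g \<midarrow>p\<rightarrow> L p"
  obtains r where "\<rho> < r" "(\<lambda>k. cmod (c k)) \<in> O(\<lambda>k. 1 / r ^ k)"
proof -
  define G where "G = remove_sings g"
  have "G analytic_on {z}" if "z \<in> ball 0 R" for z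
  proof (cases "z \<in> P")
    case True
    show ?thesis unfolding G_def
      by (rule remove_sings_analytic_at[OF isolated_singularity_at_finite[OF ana] lim])
         (use P that True in auto)
  next
    case False
    hence "g analytic_on {z}"
      using ana that analytic_on_subset by blast
    thus ?thesis unfolding G_def by (rule remove_sings_analytic_on)
  qed
  hence holo: "G holomorphic_on ball 0 R"
    by (meson analytic_imp_holomorphic analytic_on_analytic_at)
  have "g analytic_on {0}"
    by (rule analytic_on_subset[OF ana]) (use P in auto)
  hence "eventually (\<lambda>z. G z = g z) (nhds 0)"
    unfolding G_def by (rule eventually_remove_sings_eq_nhds)
  hence "G has_fps_expansion Abs_fps c"
    using fps has_fps_expansion_cong by blast
  from holomorphic_imp_coeff_bigo[OF this holo, of "(\<rho> + R) / 2"] show ?thesis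
    using P by (intro that[of "(\<rho> + R) / 2"]) auto
qed

text \<open>\<open>fact m * (k + m choose m)\<close> is the product (k + 1) ... (k + m), and one
  step adds the factor k + m + 1. Keeping the factorial avoids division in the inductions
  below.\<close>

lemma fact_choose_Suc:
  "(fact (Suc m) * of_nat (k + Suc m choose Suc m) :: real) =
     (real k + real (Suc m)) * (fact m * of_nat (k + m choose m))"
proof -
  have "Suc m * (Suc (k + m) choose Suc m) = Suc (k + m) * (k + m choose m)"
    by (rule Suc_times_binomial)
  hence "real (Suc m) * real (Suc (k + m) choose Suc m) = real (Suc (k + m)) * real (k + m choose m)"
    by (metis of_nat_mult)
  hence "fact m * (real (Suc m) * real (Suc (k + m) choose Suc m)) =
         fact m * (real (Suc (k + m)) * real (k + m choose m))"
    by (rule arg_cong)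
  thus ?thesis by (simp only: fact_Suc of_nat_mult add_Suc_right of_nat_Suc of_nat_add mult_ac add_ac)
qed

lemma fact_choose_bigo:
  "(\<lambda>k. fact m * real (k + m choose m)) \<in> O(\<lambda>k. real k ^ m)"
proof (induction m)
  case (Suc m)
  have "(\<lambda>k. real k + real (Suc m)) \<in> O(\<lambda>k. real k)"
    by (rule bigoI[where c = "real (Suc (Suc m))"], rule eventually_sequentiallyI[where c = 1])
       (use mult_left_mono[of 1 _ "1 + real m"] in \<open>simp add: algebra_simps\<close>)
  from landau_o.big.mult[OF this Suc] show ?case
    unfolding fact_choose_Suc by simp
qed simp

lemma fact_choose_asymp:
  "(\<lambda>k. fact (Suc m) * real (k + Suc m choose Suc m) - real k ^ Suc m) \<in> O(\<lambda>k. real k ^ m)"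
proof (induction m)
  case (Suc m)
  define b where "b = (\<lambda>k. fact (Suc m) * real (k + Suc m choose Suc m))"
  \<comment> \<open>The next error is k times the present one plus m + 2 times \<open>b k\<close>;
    both parts have the required order.\<close>
  have "(\<lambda>k. real k * (b k - real k ^ Suc m)) \<in> O(\<lambda>k. real k ^ Suc m)"
    using landau_o.big.mult[OF landau_o.big_refl[of real sequentially] Suc] by (simp add: b_def)
  moreover have "(\<lambda>k. real (Suc (Suc m)) * b k) \<in> O(\<lambda>k. real k ^ Suc m)"
    using fact_choose_bigo[of "Suc m"] unfolding b_def by (subst landau_o.big.cmult_in_iff) auto
  ultimately have "(\<lambda>k. real k * (b k - real k ^ Suc m) + real (Suc (Suc m)) * b k) \<in> O(\<lambda>k. real k ^ Suc m)"
    by (rule sum_in_bigo)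
  also have "(\<lambda>k. real k * (b k - real k ^ Suc m) + real (Suc (Suc m)) * b k) =
             (\<lambda>k. (real k + real (Suc (Suc m))) * b k - real k ^ Suc (Suc m))"
    by (simp add: algebra_simps)
  finally show ?case
    unfolding fact_choose_Suc[of "Suc m"] b_def .
qed simp

lemma sum_pole_terms_bigo:
  fixes L :: "complex \<Rightarrow> complex" and b f :: "nat \<Rightarrow> real"
  assumes "P \<subseteq> sphere 0 \<rho>" "0 < \<rho>" "b \<in> O(f)"
  shows "(\<lambda>k. cmod (\<Sum>p\<in>P. L p * of_real (b k) / p ^ k)) \<in> O(\<lambda>k. f k / \<rho> ^ k)"
proof -
  from assms(3) obtain C where C: "eventually (\<lambda>k. norm (b k) \<le> C * norm (f k)) sequentially"
    by (auto elim: landau_o.bigE)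
  show ?thesis
  proof (rule bigoI[where c = "(\<Sum>p\<in>P. cmod (L p)) * C"])
    from C show "eventually (\<lambda>k. norm (cmod (\<Sum>p\<in>P. L p * of_real (b k) / p ^ k)) \<le>
                   (\<Sum>p\<in>P. cmod (L p)) * C * norm (f k / \<rho> ^ k)) sequentially"
    proof eventually_elim
      case (elim k)
      have "cmod (\<Sum>p\<in>P. L p * of_real (b k) / p ^ k) \<le> (\<Sum>p\<in>P. cmod (L p * of_real (b k) / p ^ k))"
        by (rule norm_sum)
      also have "\<dots> = (\<Sum>p\<in>P. cmod (L p)) * (\<bar>b k\<bar> / \<rho> ^ k)"
        unfolding sum_distrib_right
        by (rule sum.cong) (use assms in \<open>auto simp: norm_mult norm_divide norm_power\<close>)
      also have "\<dots> \<le> (\<Sum>p\<in>P. cmod (L p)) * (C * norm (f k) / \<rho> ^ k)"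
        using elim assms by (intro mult_left_mono divide_right_mono) (auto simp: sum_nonneg)
      finally show ?case using assms by (simp add: field_simps)
    qed
  qed
qed

lemma sum_pole_terms_diff:
  fixes L :: "complex \<Rightarrow> complex"
  shows "(\<Sum>p\<in>P. L p * of_real (a - b) / p ^ k) =
           (\<Sum>p\<in>P. L p * of_real a / p ^ k) - of_real b * (\<Sum>p\<in>P. L p / p ^ k)"
  unfolding sum_distrib_left sum_subtractf[symmetric] of_real_diff
  by (rule sum.cong) (simp_all add: right_diff_distrib diff_divide_distrib)

lemma cmod_add_in_bigo:
  fixes a b :: "nat \<Rightarrow> complex" and f :: "nat \<Rightarrow> real"
  assumes "(\<lambda>k. cmod (a k)) \<in> O(f)" "(\<lambda>k. cmod (b k)) \<in> O(f)"
  shows "(\<lambda>k. cmod (a k + b k)) \<in> O(f)"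
  by (rule landau_o.big_trans[OF _ sum_in_bigo(1)[OF assms]], rule bigoI[where c = 1])
     (auto intro!: always_eventually norm_triangle_ineq)

text \<open>Each subtraction leaves another function with pole order smaller by one, hence the
  induction with \<open>g\<close>, \<open>c\<close> and \<open>L\<close> varying. The subtracted
  terms already have the claimed size.\<close>

lemma pole_imp_coeff_bigo:
  fixes c :: "nat \<Rightarrow> complex" and L :: "complex \<Rightarrow> complex"
  assumes "g has_fps_expansion Abs_fps c"
    and P: "finite P" "P \<subseteq> sphere 0 \<rho>" "0 < \<rho>" "\<rho> < R"
    and "g analytic_on ball 0 R - P"
    and "\<And>p. p \<in> P \<Longrightarrow> (\<lambda>z. (1 - z / p) ^ Suc m * g z) \<midarrow>p\<rightarrow> L p"
  shows "(\<lambda>k. cmod (c k)) \<in> O(\<lambda>k. real k ^ m / \<rho> ^ k)"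
  using assms(1,6,7)
proof (induction m arbitrary: g c L)
  case (0 g c L)
  obtain g' L' where g':
    "g' has_fps_expansion Abs_fps (\<lambda>k. c k - (\<Sum>p\<in>P. L p * of_nat (k + 0 choose 0) / p ^ k))"
    "g' analytic_on ball 0 R - P"
    "\<And>p. p \<in> P \<Longrightarrow> (\<lambda>z. (1 - z / p) ^ 0 * g' z) \<midarrow>p\<rightarrow> L' p"
    using subtract_leading_poles[OF 0(1) P 0(2,3)] by blast
  have "\<And>p. p \<in> P \<Longrightarrow> g' \<midarrow>p\<rightarrow> L' p" using g'(3) by simp
  from removable_imp_coeff_bigo[OF g'(1) P g'(2) this]
  obtain r where r: "\<rho> < r"
    "(\<lambda>k. cmod (c k - (\<Sum>p\<in>P. L p / p ^ k))) \<in> O(\<lambda>k. 1 / r ^ k)" by auto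
  have "(\<lambda>k. 1 / r ^ k) \<in> O(\<lambda>k. 1 / \<rho> ^ k)"
    using r P by (intro bigoI[where c = 1] always_eventually) (auto simp: field_simps intro!: power_mono)
  hence "(\<lambda>k. cmod (c k - (\<Sum>p\<in>P. L p / p ^ k))) \<in> O(\<lambda>k. 1 / \<rho> ^ k)"
    using r(2) landau_o.big_trans by blast
  moreover have "(\<lambda>k. cmod (\<Sum>p\<in>P. L p / p ^ k)) \<in> O(\<lambda>k. 1 / \<rho> ^ k)"
    using sum_pole_terms_bigo[OF P(2,3), of "\<lambda>_. 1" "\<lambda>_. 1" L] by simp
  ultimately show ?case
    using cmod_add_in_bigo by fastforce
next
  case (Suc m g c L)
  obtain g' L' where g':
    "g' has_fps_expansion Abs_fps (\<lambda>k. c k - (\<Sum>p\<in>P. L p * of_nat (k + Suc m choose Suc m) / p ^ k))"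
    "g' analytic_on ball 0 R - P"
    "\<And>p. p \<in> P \<Longrightarrow> (\<lambda>z. (1 - z / p) ^ Suc m * g' z) \<midarrow>p\<rightarrow> L' p"
    using subtract_leading_poles[OF Suc(2) P Suc(3,4)] by blast
  have "(\<lambda>k. cmod (c k - (\<Sum>p\<in>P. L p * of_nat (k + Suc m choose Suc m) / p ^ k)))
          \<in> O(\<lambda>k. real k ^ m / \<rho> ^ k)"
    by (rule Suc.IH[OF g'])
  moreover have "(\<lambda>k. real k ^ m / \<rho> ^ k) \<in> O(\<lambda>k. real k ^ Suc m / \<rho> ^ k)"
    using P by (intro bigoI[where c = 1] eventually_sequentiallyI[where c = 1])
               (auto simp: abs_mult field_simps)
  ultimately have *: "(\<lambda>k. cmod (c k - (\<Sum>p\<in>P. L p * of_nat (k + Suc m choose Suc m) / p ^ k)))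
          \<in> O(\<lambda>k. real k ^ Suc m / \<rho> ^ k)"
    using landau_o.big_trans by blast
  have "(\<lambda>k. real (k + Suc m choose Suc m)) \<in> O(\<lambda>k. real k ^ Suc m)"
    using fact_choose_bigo[of "Suc m"] by (subst (asm) landau_o.big.cmult_in_iff) auto
  from cmod_add_in_bigo[OF * sum_pole_terms_bigo[OF P(2,3) this, of L]] show ?case
    by (simp only: of_real_of_nat_eq diff_add_cancel)
qed

text \<open>Subtracting the leading poles gives the exact weight \<open>k + m' choose m'\<close>.
  Replacing it by \<open>k ^ m' / fact m'\<close> costs one power of k, the same as the remaining
  poles. For \<open>m = 1\<close> the weight is 1 and no pole remains.\<close>

theorem coeff_asymp_poles_on_circle:
  fixes c :: "nat \<Rightarrow> complex" and L :: "complex \<Rightarrow> complex"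
  assumes fps: "g has_fps_expansion Abs_fps c"
    and P: "finite P" "P \<subseteq> sphere 0 \<rho>" "0 < \<rho>" "\<rho> < R"
    and ana: "g analytic_on ball 0 R - P"
    and lim: "\<And>p. p \<in> P \<Longrightarrow> (\<lambda>z. (1 - z / p) ^ m * g z) \<midarrow>p\<rightarrow> L p"
    and m: "m \<ge> 1"
  defines "E \<equiv> (\<lambda>k. cmod (c k - of_real (real k ^ (m - 1) / fact (m - 1)) * (\<Sum>p\<in>P. L p / p ^ k)))"
  shows "\<exists>\<epsilon>>0. (m = 1 \<longrightarrow> E \<in> O(\<lambda>k. 1 / (\<rho> + \<epsilon>) ^ k)) \<and>
                (m \<ge> 2 \<longrightarrow> E \<in> O(\<lambda>k. real k ^ (m - 2) / \<rho> ^ k))"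
proof -
  from m obtain m' where m': "m = Suc m'" by (cases m) auto
  obtain g' L' where g':
    "g' has_fps_expansion Abs_fps (\<lambda>k. c k - (\<Sum>p\<in>P. L p * of_nat (k + m' choose m') / p ^ k))"
    "g' analytic_on ball 0 R - P"
    "\<And>p. p \<in> P \<Longrightarrow> (\<lambda>z. (1 - z / p) ^ m' * g' z) \<midarrow>p\<rightarrow> L' p"
    using subtract_leading_poles[OF fps P ana lim[unfolded m']] by blast
  show ?thesis
  proof (cases m')
    case 0
    have "\<And>p. p \<in> P \<Longrightarrow> g' \<midarrow>p\<rightarrow> L' p" using g'(3) 0 by simp
    from removable_imp_coeff_bigo[OF g'(1) P g'(2) this]
    obtain r where r: "\<rho> < r"
      "(\<lambda>k. cmod (c k - (\<Sum>p\<in>P. L p / p ^ k))) \<in> O(\<lambda>k. 1 / r ^ k)" by (auto simp: 0)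
    thus ?thesis
      by (intro exI[of _ "r - \<rho>"]) (auto simp: E_def m' 0)
  next
    case (Suc n)
    have *: "(\<lambda>k. cmod (c k - (\<Sum>p\<in>P. L p * of_nat (k + m' choose m') / p ^ k)))
          \<in> O(\<lambda>k. real k ^ n / \<rho> ^ k)"
      using g' unfolding Suc by (intro pole_imp_coeff_bigo[OF _ P])
    have "(\<lambda>k. (1 / fact m') * (fact (Suc n) * real (k + Suc n choose Suc n) - real k ^ Suc n))
            \<in> O(\<lambda>k. real k ^ n)"
      using fact_choose_asymp by (subst landau_o.big.cmult_in_iff) auto
    hence "(\<lambda>k. real (k + m' choose m') - real k ^ m' / fact m') \<in> O(\<lambda>k. real k ^ n)"
      unfolding Suc by (simp add: diff_divide_distrib del: fact_Suc)
    from cmod_add_in_bigo[OF * sum_pole_terms_bigo[OF P(2,3) this, of L]]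
    have "E \<in> O(\<lambda>k. real k ^ n / \<rho> ^ k)"
      unfolding E_def m' sum_pole_terms_diff by (simp only: diff_Suc_1 of_real_of_nat_eq add_diff_eq diff_add_cancel)
    \<comment> \<open>Any positive \<epsilon> does here, since only the clause for
      \<open>m = 1\<close> mentions it.\<close>
    thus ?thesis
      by (intro exI[of _ 1]) (auto simp: m' Suc)
  qed
qed

subsection \<open>Perron theory for nonnegative irreducible matrices\<close>

lemma irreducible_on_closed_set:
  assumes "irreducible_on UNIV P" "i \<in> S" "\<And>i j. i \<in> S \<Longrightarrow> P i j > 0 \<Longrightarrow> j \<in> S"
  shows "j \<in> S"
proof -
  have "(i, j) \<in> {(u, v). u \<in> UNIV \<and> v \<in> UNIV \<and> P u v > 0}\<^sup>*"
    using assms(1) unfolding irreducible_on_def by blast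
  thus ?thesis
    by (induction rule: rtrancl_induct) (use assms in auto)
qed

text \<open>The smallest multiple of \<open>v\<close> dominating \<open>w\<close> touches it at some
  index; the comparison arguments below look at such an index.\<close>

lemma Max_ratio_witness:
  fixes v w :: "real^'n::finite"
  assumes "\<And>i. v $ i > 0" "\<And>i. w $ i \<ge> 0" "w \<noteq> 0"
  obtains c i where "c > 0" "w $ i = c * v $ i" "\<And>j. w $ j \<le> c * v $ j"
proof -
  define c where "c = Max (range (\<lambda>i. w $ i / v $ i))"
  have le: "w $ j / v $ j \<le> c" for j
    unfolding c_def by (intro Max_ge) auto
  have "c \<in> range (\<lambda>i. w $ i / v $ i)"
    unfolding c_def by (intro Max_in) auto
  then obtain i where i: "c = w $ i / v $ i" by auto
  from \<open>w \<noteq> 0\<close> obtain k where "w $ k \<noteq> 0" by (auto simp: vec_eq_iff)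
  hence "0 < w $ k / v $ k" using assms(1)[of k] assms(2)[of k] by simp
  hence "c > 0" using le[of k] by linarith
  moreover have "w $ i = c * v $ i"
    using i assms(1)[of i] by (simp add: field_simps)
  moreover have "w $ j \<le> c * v $ j" for j
    using le[of j] assms(1)[of j] by (simp add: field_simps)
  ultimately show ?thesis by (rule that)
qed

lemma matrix_vector_mult_le_scaled:
  fixes X :: "real^'n::finite^'m"
  assumes "\<And>i j. X $ i $ j \<ge> 0" "\<And>j. w $ j \<le> c * v $ j"
  shows "(X *v w) $ i \<le> c * (X *v v) $ i"
proof -
  have "(X *v w) $ i \<le> (\<Sum>j\<in>UNIV. X $ i $ j * (c * v $ j))"
    unfolding matrix_vector_mult_def using assms by (auto intro!: sum_mono mult_left_mono)
  also have "\<dots> = c * (X *v v) $ i"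
    by (simp add: matrix_vector_mult_def sum_distrib_left mult.left_commute)
  finally show ?thesis .
qed

text \<open>A strong maximum principle. Where \<open>w\<close> touches the dominating multiple of
  \<open>v\<close>, both inequalities are equalities, and \<open>w\<close> then touches at every
  successor as well; irreducibility carries this to all indices.\<close>

lemma supersolution_with_subsolution_imp_eq:
  fixes X :: "real^'n::finite^'n"
  assumes X: "\<And>i j. X $ i $ j \<ge> 0" and irr: "irreducible_on UNIV (\<lambda>i j. X $ i $ j)"
    and v: "\<And>i. v $ i > 0" and sup: "\<And>i. (X *v v) $ i \<le> s * v $ i"
    and w: "\<And>i. w $ i \<ge> 0" "w \<noteq> 0" and sub: "\<And>i. s * w $ i \<le> (X *v w) $ i"
  shows "(X *v v) $ i = s * v $ i"
proof -
  from Max_ratio_witness[OF v w] obtain c i0 where c: "c > 0" "w $ i0 = c * v $ i0"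
    "\<And>j. w $ j \<le> c * v $ j" by metis
  define S where "S = {i. w $ i = c * v $ i}"
  have eq: "(X *v w) $ i = c * (X *v v) $ i \<and> (X *v v) $ i = s * v $ i" if "i \<in> S" for i
  proof -
    have "(X *v w) $ i \<le> c * (X *v v) $ i"
      by (rule matrix_vector_mult_le_scaled) (use c X in auto)
    moreover have "c * (X *v v) $ i \<le> c * (s * v $ i)"
      using c sup by (intro mult_left_mono) auto
    moreover have "c * (s * v $ i) \<le> (X *v w) $ i"
      using sub[of i] that by (simp add: S_def mult_ac)
    ultimately have "(X *v w) $ i = c * (X *v v) $ i" "c * (X *v v) $ i = c * (s * v $ i)"
      by linarith+
    thus ?thesis using c by simp
  qed
  have "j \<in> S" if "i \<in> S" "X $ i $ j > 0" for i j
  proof -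
    have "(\<Sum>j\<in>UNIV. X $ i $ j * (c * v $ j - w $ j)) = c * (X *v v) $ i - (X *v w) $ i"
      by (simp add: matrix_vector_mult_def right_diff_distrib sum_subtractf sum_distrib_left mult_ac)
    hence "(\<Sum>j\<in>UNIV. X $ i $ j * (c * v $ j - w $ j)) = 0"
      using eq[OF that(1)] by simp
    hence "X $ i $ j * (c * v $ j - w $ j) = 0"
      using c X by (subst (asm) sum_nonneg_eq_0_iff) auto
    thus ?thesis using that by (simp add: S_def)
  qed
  hence "i \<in> S"
    using irreducible_on_closed_set[OF irr, of i0 S] c(2) by (auto simp: S_def)
  thus ?thesis using eq by blast
qed

lemma eigenvector_cmod_subsolution:
  fixes Y :: "complex^'n::finite^'n"
  assumes "\<And>i j. cmod (Y $ i $ j) \<le> X $ i $ j" "Y *v y = \<mu> *s y"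
  shows "cmod \<mu> * cmod (y $ i) \<le> (X *v (\<chi> i. cmod (y $ i))) $ i"
proof -
  have "cmod \<mu> * cmod (y $ i) = cmod ((Y *v y) $ i)"
    using assms(2) by (simp add: norm_mult)
  also have "\<dots> \<le> (\<Sum>j\<in>UNIV. cmod (Y $ i $ j * y $ j))"
    unfolding matrix_vector_mult_def by (simp add: norm_sum)
  also have "\<dots> \<le> (\<Sum>j\<in>UNIV. X $ i $ j * cmod (y $ j))"
    using assms(1) by (intro sum_mono) (simp add: norm_mult mult_right_mono)
  finally show ?thesis by (simp add: matrix_vector_mult_def)
qed

text \<open>The Collatz-Wielandt bound, read off at an index where the moduli of the eigenvector
  touch a multiple of \<open>v\<close>.\<close>

lemma eigenvalue_le_supersolution:
  fixes Y :: "complex^'n::finite^'n"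
  assumes Y: "\<And>i j. cmod (Y $ i $ j) \<le> X $ i $ j" "Y *v y = \<mu> *s y" "y \<noteq> 0"
    and v: "\<And>i. v $ i > 0" and sup: "\<And>i. (X *v v) $ i \<le> s * v $ i"
  shows "cmod \<mu> \<le> s"
proof -
  define w where "w = (\<chi> i. cmod (y $ i))"
  have X: "X $ i $ j \<ge> 0" for i j
    using Y(1)[of i j] norm_ge_zero[of "Y $ i $ j"] by linarith
  have "w \<noteq> 0" using \<open>y \<noteq> 0\<close> by (auto simp: w_def vec_eq_iff)
  then obtain c i where c: "c > 0" "w $ i = c * v $ i" "\<And>j. w $ j \<le> c * v $ j"
    using Max_ratio_witness[OF v, of w] by (metis vec_lambda_beta norm_ge_zero w_def)
  have "cmod \<mu> * w $ i \<le> (X *v w) $ i"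
    using eigenvector_cmod_subsolution[OF Y(1,2)] by (simp add: w_def)
  also have "\<dots> \<le> c * (X *v v) $ i"
    by (rule matrix_vector_mult_le_scaled) (use c X in auto)
  also have "\<dots> \<le> c * (s * v $ i)"
    using c sup by (intro mult_left_mono) auto
  also have "\<dots> = s * w $ i" using c by simp
  finally show ?thesis using c v[of i] by simp
qed

text \<open>Brouwer's theorem on the probability simplex; adding the identity keeps the normalising
  factor at least \<open>1\<close>.\<close>

lemma positive_eigenvector_exists:
  fixes X :: "real^'n::finite^'n"
  assumes X: "\<And>i j. X $ i $ j \<ge> 0" and irr: "irreducible_on UNIV (\<lambda>i j. X $ i $ j)"
  obtains u l where "\<And>i. u $ i > 0" "X *v u = l *s u"
proof -
  define S where "S = {w :: real^'n. (\<forall>i. 0 \<le> w $ i) \<and> (\<Sum>i\<in>UNIV. w $ i) = 1}"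
  define \<sigma> where "\<sigma> = (\<lambda>w :: real^'n. \<Sum>i\<in>UNIV. (w + X *v w) $ i)"
  define f where "f = (\<lambda>w. (1 / \<sigma> w) *s (w + X *v w))"
  have Xw: "(X *v w) $ i \<ge> 0" if "w \<in> S" for w i
    unfolding matrix_vector_mult_def using that X by (auto simp: S_def intro!: sum_nonneg)
  have \<sigma>: "\<sigma> w \<ge> 1" if "w \<in> S" for w
  proof -
    have "\<sigma> w = 1 + (\<Sum>i\<in>UNIV. (X *v w) $ i)"
      using that by (simp add: \<sigma>_def sum.distrib S_def)
    thus ?thesis using Xw[OF that] by (simp add: sum_nonneg)
  qed
  have "closed S"
    unfolding S_def by (intro closed_Collect_conj closed_Collect_all closed_Collect_le
      closed_Collect_eq continuous_intros)
  moreover have "bounded S"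
  proof (rule boundedI[of _ 1])
    fix w assume "w \<in> S"
    thus "norm w \<le> 1" using norm_le_l1_cart[of w] by (simp add: S_def)
  qed
  ultimately have "compact S" by (simp add: compact_eq_bounded_closed)
  moreover have "convex S"
    unfolding convex_def S_def
    by (auto simp: sum.distrib sum_distrib_left[symmetric])
  moreover have "S \<noteq> {}"
    by (auto simp: S_def intro!: exI[of _ "axis undefined 1"]) (auto simp: axis_def)
  moreover have "continuous_on S f"
  proof -
    have "continuous_on S (\<lambda>w. (1 / \<sigma> w) *\<^sub>R (w + X *v w))"
      unfolding \<sigma>_def
      by (intro continuous_intros matrix_vector_mult_linear_continuous_on)
         (use \<sigma> in \<open>force simp: \<sigma>_def\<close>)
    thus ?thesis by (simp add: f_def scalar_mult_eq_scaleR)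
  qed
  moreover have "f \<in> S \<rightarrow> S"
  proof
    fix w assume w: "w \<in> S"
    have "(\<Sum>i\<in>UNIV. f w $ i) = 1"
      using \<sigma>[OF w] by (simp add: f_def sum_divide_distrib[symmetric] sum.distrib[symmetric]
          add_divide_distrib[symmetric] \<sigma>_def)
    moreover have "f w $ i \<ge> 0" for i
      using \<sigma>[OF w] Xw[OF w] w by (simp add: f_def S_def)
    ultimately show "f w \<in> S" by (simp add: S_def)
  qed
  ultimately obtain u where u: "u \<in> S" "f u = u"
    by (rule brouwer)
  \<comment> \<open>\<open>\<sigma> u\<close> is the eigenvalue of I + X, hence the shift by
    1.\<close>
  have "(X *v u) $ i = (\<sigma> u - 1) * u $ i" for i
  proof -
    have "u $ i = (1 / \<sigma> u) * (u $ i + (X *v u) $ i)"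
      using arg_cong[OF u(2), of "\<lambda>w. w $ i"] by (simp add: f_def add_divide_distrib)
    thus ?thesis using \<sigma>[OF u(1)] by (simp add: field_simps)
  qed
  hence eig: "X *v u = (\<sigma> u - 1) *s u" by (simp add: vec_eq_iff left_diff_distrib)
  have "u $ i > 0" for i
  proof (rule ccontr)
    assume "\<not> u $ i > 0"
    hence i: "u $ i = 0" using u(1) by (auto simp: S_def less_le)
    \<comment> \<open>Zeros of \<open>u\<close> propagate to successors, so a single one would make
      \<open>u\<close> vanish, against total mass 1.\<close>
    have "u $ j = 0" if "u $ i = 0" "X $ i $ j > 0" for i j
    proof -
      have "(\<Sum>j\<in>UNIV. X $ i $ j * u $ j) = 0"
        using arg_cong[OF eig, of "\<lambda>w. w $ i"] that by (simp add: matrix_vector_mult_def)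
      hence "X $ i $ j * u $ j = 0"
        using X u(1) by (subst (asm) sum_nonneg_eq_0_iff) (auto simp: S_def)
      thus ?thesis using that by simp
    qed
    hence "j \<in> {i. u $ i = 0}" for j
      using irreducible_on_closed_set[OF irr, of i "{i. u $ i = 0}"] i by auto
    thus False using u(1) by (auto simp: S_def)
  qed
  with eig show ?thesis by (rule that[rotated])
qed

text \<open>A positive eigenvector is its own supersolution, so \<open>l\<close> bounds all
  eigenvalues in modulus. Uniqueness: a number of modulus \<open>l\<close> whose real part is at
  least \<open>l\<close> equals \<open>l\<close>.\<close>

lemma delta_eq_positive_eigenvalue:
  fixes X :: "real^'n::finite^'n"
  assumes X: "\<And>i j. X $ i $ j \<ge> 0" and u: "\<And>i. u $ i > 0" "X *v u = l *s u"
  shows "delta (\<chi> i j. complex_of_real (X $ i $ j)) = of_real l"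
proof -
  define Y where "Y = (\<chi> i j. complex_of_real (X $ i $ j))"
  have "(X *v u) $ undefined \<ge> 0"
    unfolding matrix_vector_mult_def using X u(1) by (auto intro!: sum_nonneg simp: less_imp_le)
  hence l: "l \<ge> 0" using u(1)[of undefined] u(2) by (simp add: zero_le_mult_iff less_le_not_le)
  have le: "cmod \<mu> \<le> l" if "is_eigenvalue Y \<mu>" for \<mu>
  proof -
    from that obtain y where "y \<noteq> 0" "Y *v y = \<mu> *s y" by (auto simp: is_eigenvalue_def)
    thus ?thesis
      by (intro eigenvalue_le_supersolution[of Y X y \<mu> u]) (use X u in \<open>auto simp: Y_def\<close>)
  qed
  have eig: "is_eigenvalue Y (of_real l)"
    unfolding is_eigenvalue_def
  proof (intro exI conjI)
    show "(\<chi> i. complex_of_real (u $ i)) \<noteq> 0"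
      using u(1)[of undefined] by (auto simp: vec_eq_iff intro: exI[of _ undefined])
    have "complex_of_real ((X *v u) $ i) = of_real (l * u $ i)" for i
      using u(2) by simp
    thus "Y *v (\<chi> i. complex_of_real (u $ i)) = of_real l *s (\<chi> i. complex_of_real (u $ i))"
      by (simp add: vec_eq_iff matrix_vector_mult_def Y_def)
  qed
  show ?thesis
    unfolding delta_def Y_def[symmetric]
  proof (rule the_equality)
    show "is_eigenvalue Y (of_real l) \<and>
      (\<forall>\<mu>. is_eigenvalue Y \<mu> \<longrightarrow> cmod \<mu> \<le> cmod (of_real l)) \<and>
      0 \<le> Arg (of_real l) \<and>
      (\<forall>\<mu>. is_eigenvalue Y \<mu> \<and> cmod \<mu> = cmod (of_real l) \<longrightarrow> Re \<mu> \<le> Re (of_real l))"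
      using eig le l by (auto simp: Arg_of_real intro: order_trans[OF complex_Re_le_cmod])
  next
    fix k assume k: "is_eigenvalue Y k \<and>
      (\<forall>\<mu>. is_eigenvalue Y \<mu> \<longrightarrow> cmod \<mu> \<le> cmod k) \<and> 0 \<le> Arg k \<and>
      (\<forall>\<mu>. is_eigenvalue Y \<mu> \<and> cmod \<mu> = cmod k \<longrightarrow> Re \<mu> \<le> Re k)"
    hence "cmod k = l" using le[of k] eig l by (metis abs_of_nonneg antisym norm_of_real)
    moreover have "Re k \<ge> l" using k eig l \<open>cmod k = l\<close> by fastforce
    ultimately have "Re k = l" using complex_Re_le_cmod[of k] by linarith
    with \<open>cmod k = l\<close> have "Im k = 0"
      by (metis cmod_eq_Re l abs_of_nonneg complex_is_Real_iff norm_complex_def cmod_power2 add_cancel_left_right power_eq_0_iff zero_neq_numeral)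
    with \<open>Re k = l\<close> show "k = of_real l" by (simp add: complex_eq_iff)
  qed
qed

text \<open>With \<open>G = a powr t\<close>, both a and 1 are \<open>G\<close> times an
  exponential, with exponents \<open>(1 - t) * ln a\<close> and \<open>- t * ln a\<close>. In the
  tangent bounds exp y \<ge> 1 + y, weighted by t and 1 - t, the linear terms cancel; equality
  forces \<open>ln a = 0\<close>.\<close>

lemma powr_le_weighted:
  fixes a t :: real
  assumes "a > 0" "0 < t" "t < 1"
  shows "a powr t \<le> t * a + (1 - t)" and "a powr t = t * a + (1 - t) \<Longrightarrow> a = 1"
proof -
  define G where "G = a powr t"
  have G: "G > 0" using assms by (simp add: G_def)
  have a: "a = G * exp ((1 - t) * ln a)"
    using assms by (simp add: G_def powr_def exp_add[symmetric] algebra_simps)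
  have one: "1 = G * exp (- t * ln a)"
    using assms by (simp add: G_def powr_def exp_add[symmetric])
  have "t * (G * exp ((1 - t) * ln a)) \<ge> t * (G * (1 + (1 - t) * ln a))"
    using assms G by (intro mult_left_mono exp_ge_add_one_self) auto
  moreover have le2: "(1 - t) * (G * exp (- t * ln a)) \<ge> (1 - t) * (G * (1 + (- t * ln a)))"
    using assms G by (intro mult_left_mono exp_ge_add_one_self) auto
  moreover have id: "t * (G * (1 + (1 - t) * ln a)) + (1 - t) * (G * (1 + (- t * ln a))) = G"
    by (simp add: algebra_simps)
  ultimately show "a powr t \<le> t * a + (1 - t)"
    using a one by (simp add: G_def[symmetric])
  assume eq: "a powr t = t * a + (1 - t)"
  show "a = 1"
  proof (rule ccontr)
    assume "a \<noteq> 1"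
    hence "(1 - t) * ln a \<noteq> 0" using assms by simp
    hence "exp ((1 - t) * ln a) > 1 + (1 - t) * ln a"
      using exp_minus_greater[of "- ((1 - t) * ln a)"] by simp
    hence "t * (G * exp ((1 - t) * ln a)) > t * (G * (1 + (1 - t) * ln a))"
      using assms G by simp
    thus False using le2 id a one eq by (simp add: G_def[symmetric])
  qed
qed

subsection \<open>The kernel of the chain\<close>

text \<open>The real counterpart of \<open>Astar\<close>: for nonnegative A its value at
  \<open>cmod z\<close> dominates \<open>Astar A z\<close> entrywise, and order arguments apply to
  it.\<close>

definition real_powser_mat :: "(nat \<Rightarrow> real^'m^'n) \<Rightarrow> real \<Rightarrow> real^'m^'n" where
  "real_powser_mat A s = (\<chi> i j. \<Sum>k. s ^ k * A k $ i $ j)"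

text \<open>The radius is that of the matrix-valued sequence, and every entry is dominated by the
  matrix norm. The field is general because real and complex arguments both occur.\<close>

lemma summable_powser_entry:
  fixes A :: "nat \<Rightarrow> real^'m::finite^'n::finite" and z :: "'a::{real_normed_field,banach}"
  assumes "ereal (norm z) < conv_radius A"
  shows "summable (\<lambda>k. norm (z ^ k * of_real (A k $ i $ j)))"
proof (rule summable_comparison_test')
  show "summable (\<lambda>k. norm (norm (A k) * norm z ^ k))"
    by (rule abs_summable_in_conv_radius) (use assms in simp)
  fix k
  have "\<bar>A k $ i $ j\<bar> \<le> norm (A k)"
    using Finite_Cartesian_Product.norm_nth_le[of "A k $ i" j]
      Finite_Cartesian_Product.norm_nth_le[of "A k" i] by simp
  thus "norm (norm (z ^ k * of_real (A k $ i $ j))) \<le> norm (norm (A k) * norm z ^ k)"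
    by (simp add: norm_mult norm_power mult.commute[of "norm (A k)"] mult_left_mono)
qed

lemma sums_real_powser_mat:
  fixes A :: "nat \<Rightarrow> real^'m::finite^'n::finite"
  assumes "0 \<le> s" "ereal s < conv_radius A"
  shows "(\<lambda>k. s ^ k * A k $ i $ j) sums real_powser_mat A s $ i $ j"
  unfolding real_powser_mat_def
  using summable_powser_entry[of s A i j] assms
  by (auto intro!: summable_sums dest: summable_rabs_cancel)

lemma Astar_of_real:
  fixes A :: "nat \<Rightarrow> real^'m::finite^'n::finite"
  assumes "0 \<le> s" "ereal s < conv_radius A"
  shows "Astar A (of_real s) $ i $ j = of_real (real_powser_mat A s $ i $ j)"
  using sums_of_real[OF sums_real_powser_mat[OF assms, of i j], where 'a = complex]
  by (simp add: Astar_def sums_iff)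

lemma cmod_Astar_le:
  fixes A :: "nat \<Rightarrow> real^'m::finite^'n::finite"
  assumes "\<And>k i j. A k $ i $ j \<ge> 0" "ereal (cmod z) < conv_radius A"
  shows "cmod (Astar A z $ i $ j) \<le> real_powser_mat A (cmod z) $ i $ j"
proof -
  have "cmod (\<Sum>k. z ^ k * of_real (A k $ i $ j)) \<le> (\<Sum>k. cmod (z ^ k * of_real (A k $ i $ j)))"
    by (rule summable_norm) (rule summable_powser_entry[OF assms(2)])
  thus ?thesis using assms(1)
    by (simp add: Astar_def real_powser_mat_def norm_mult norm_power)
qed

locale mg1_kernel =
  fixes A :: "nat \<Rightarrow> real^'m::finite^'m" and pi :: "real^'m" and theta :: real
  assumes A_nonneg: "\<And>k i j. A k $ i $ j \<ge> 0"
    and A_stoch: "\<And>i. (\<lambda>k. \<Sum>j\<in>UNIV. A k $ i $ j) sums 1"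
    and pi_stat: "pi v* msum A = pi"
    and pi_norm: "(\<Sum>j\<in>UNIV. pi $ j) = 1"
    and A_irred: "irreducible_on UNIV (\<lambda>i j. msum A $ i $ j)"
    and drift: "(\<Sum>i\<in>UNIV. pi $ i * (\<Sum>k. real k * (\<Sum>j\<in>UNIV. A k $ i $ j))) < 1"
    and theta_gt1: "1 < theta"
    and theta_lt_rA: "ereal theta < conv_radius A"
    and theta_delta: "complex_of_real theta = delta (Astar A (complex_of_real theta))"
begin

lemma lt_conv_radius: "s \<le> theta \<Longrightarrow> ereal s < conv_radius A"
  by (rule le_less_trans[OF _ theta_lt_rA]) simp

lemma A_sums_msum: "(\<lambda>k. A k $ i $ j) sums msum A $ i $ j"
  using sums_real_powser_mat[of 1 A i j] lt_conv_radius[of 1] theta_gt1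
  by (simp add: real_powser_mat_def msum_def)

lemma msum_row: "(\<Sum>j\<in>UNIV. msum A $ i $ j) = 1"
  using sums_sum[of UNIV "\<lambda>j k. A k $ i $ j" "\<lambda>j. msum A $ i $ j"] A_sums_msum A_stoch[of i]
  by (auto intro: sums_unique2)

lemma real_powser_mat_nonneg:
  assumes "0 \<le> s" "s \<le> theta"
  shows "real_powser_mat A s $ i $ j \<ge> 0"
  by (rule sums_le[OF _ sums_zero sums_real_powser_mat[OF assms(1) lt_conv_radius[OF assms(2)]]])
     (use A_nonneg assms in auto)

text \<open>For \<open>s > 0\<close> an entry is positive exactly when it is positive in some
  \<open>A k\<close>, so the positivity pattern is that of \<open>msum A\<close>.\<close>

lemma irreducible_real_powser_mat:
  assumes "0 < s" "s \<le> theta"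
  shows "irreducible_on UNIV (\<lambda>i j. real_powser_mat A s $ i $ j)"
proof -
  have "real_powser_mat A s $ i $ j > 0 \<longleftrightarrow> msum A $ i $ j > 0" for i j
  proof -
    note S = sums_real_powser_mat[OF less_imp_le[OF assms(1)] lt_conv_radius[OF assms(2)], of i j]
    have "real_powser_mat A s $ i $ j > 0 \<longleftrightarrow> (\<exists>k. 0 < s ^ k * A k $ i $ j)"
      using suminf_pos_iff[OF sums_summable[OF S]] A_nonneg assms S by (simp add: sums_iff)
    also have "\<dots> \<longleftrightarrow> (\<exists>k. 0 < A k $ i $ j)"
      using assms by (simp add: zero_less_mult_iff)
    also have "\<dots> \<longleftrightarrow> msum A $ i $ j > 0"
      using suminf_pos_iff[OF sums_summable[OF A_sums_msum[of i j]]] A_nonneg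
        sums_unique[OF A_sums_msum[of i j]] by simp
    finally show ?thesis .
  qed
  thus ?thesis using A_irred by (simp add: irreducible_on_def)
qed

text \<open>The fixed point argument gives a positive eigenvector for an unspecified eigenvalue; the
  description of \<open>delta\<close> identifies it as \<open>theta\<close>.\<close>

lemma theta_eigenvector:
  obtains u where "\<And>i. u $ i > 0" "real_powser_mat A theta *v u = theta *s u"
proof -
  define X where "X = real_powser_mat A theta"
  have X: "X $ i $ j \<ge> 0" for i j
    unfolding X_def by (rule real_powser_mat_nonneg) (use theta_gt1 in auto)
  have "irreducible_on UNIV (\<lambda>i j. X $ i $ j)"
    unfolding X_def by (rule irreducible_real_powser_mat) (use theta_gt1 in auto)
  from positive_eigenvector_exists[OF X this]
  obtain u l where u: "\<And>i. u $ i > 0" "X *v u = l *s u" by metis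
  have "Astar A (of_real theta) = (\<chi> i j. of_real (X $ i $ j))"
    using Astar_of_real[of theta A] theta_gt1 theta_lt_rA by (simp add: vec_eq_iff X_def)
  with delta_eq_positive_eigenvalue[OF X u] theta_delta have "l = theta"
    by simp
  with u show ?thesis by (intro that[of u]) (auto simp: X_def)
qed

text \<open>If every transition with positive weight were balanced in this sense, then
  \<open>log\<^bsub>theta\<^esub> u\<close> would be a potential for the level increments and the mean drift would be
  exactly \<open>0\<close>.\<close>

lemma not_all_balanced:
  assumes u: "\<And>i. u $ i > 0"
    and bal: "\<And>i j k. A k $ i $ j > 0 \<Longrightarrow> theta ^ k * u $ j = theta * u $ i"
  shows False
proof -
  define w where "w = (\<lambda>i. log theta (u $ i))"
  \<comment> \<open>In logarithms the balance reads k = 1 + w i - w j; the weight as a factor makes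
    it hold for vanishing entries too.\<close>
  have k: "real k * A k $ i $ j = A k $ i $ j * (1 + w i - w j)" for i j k
  proof (cases "A k $ i $ j > 0")
    case True
    have "log theta (theta ^ k * u $ j) = real k + w j"
      using theta_gt1 u[of j] by (simp add: log_mult log_nat_power w_def)
    moreover have "log theta (theta * u $ i) = 1 + w i"
      using theta_gt1 u[of i] by (simp add: log_mult w_def)
    ultimately have "real k = 1 + w i - w j" using bal[OF True] by simp
    thus ?thesis by simp
  next
    case False
    thus ?thesis using A_nonneg[of k i j] by simp
  qed
  have "(\<Sum>k. real k * (\<Sum>j\<in>UNIV. A k $ i $ j)) = (\<Sum>j\<in>UNIV. msum A $ i $ j * (1 + w i - w j))" for i
  proof -
    have "(\<lambda>k. \<Sum>j\<in>UNIV. A k $ i $ j * (1 + w i - w j)) sums (\<Sum>j\<in>UNIV. msum A $ i $ j * (1 + w i - w j))"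
      by (intro sums_sum sums_mult2 A_sums_msum)
    thus ?thesis by (simp add: sum_distrib_left k sums_iff)
  qed
  also have "(\<Sum>j\<in>UNIV. msum A $ i $ j * (1 + w i - w j)) =
             1 + w i - (\<Sum>j\<in>UNIV. msum A $ i $ j * w j)" for i
    by (simp add: right_diff_distrib sum_subtractf sum_distrib_right[symmetric] msum_row)
  finally have "(\<Sum>i\<in>UNIV. pi $ i * (\<Sum>k. real k * (\<Sum>j\<in>UNIV. A k $ i $ j))) =
     (\<Sum>i\<in>UNIV. pi $ i * (1 + w i - (\<Sum>j\<in>UNIV. msum A $ i $ j * w j)))"
    by simp
  also have "\<dots> = 1 + (\<Sum>i\<in>UNIV. pi $ i * w i) - (\<Sum>i\<in>UNIV. \<Sum>j\<in>UNIV. pi $ i * (msum A $ i $ j * w j))"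
    by (simp add: right_diff_distrib ring_distribs sum.distrib sum_subtractf pi_norm sum_distrib_left)
  \<comment> \<open>By stationarity of \<open>pi\<close> the potentials cancel and the value 1
    remains.\<close>
  also have "(\<Sum>i\<in>UNIV. \<Sum>j\<in>UNIV. pi $ i * (msum A $ i $ j * w j)) =
             (\<Sum>j\<in>UNIV. (pi v* msum A) $ j * w j)"
    by (subst sum.swap) (simp add: vector_matrix_mult_def sum_distrib_right sum_distrib_left mult_ac)
  finally show False using drift by (simp add: pi_stat)
qed

text \<open>The vector is \<open>u\<^sup>t\<close>, where \<open>s = theta\<^sup>t\<close> and \<open>u\<close> is the Perron vector at \<open>theta\<close>: weighted
  AM-GM interpolates between \<open>A\<^sup>*(1) e = e\<close> and \<open>A\<^sup>*(theta) u = theta u\<close>.\<close>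

lemma strict_supersolution:
  assumes s: "1 < s" "s < theta"
  obtains v i where "\<And>i. v $ i > 0" "\<And>i. (real_powser_mat A s *v v) $ i \<le> s * v $ i"
    "(real_powser_mat A s *v v) $ i \<noteq> s * v $ i"
proof -
  obtain u where u: "\<And>i. u $ i > 0" "real_powser_mat A theta *v u = theta *s u"
    using theta_eigenvector by metis
  define t where "t = log theta s"
  have t: "0 < t" "t < 1" using s theta_gt1 by (auto simp: t_def)
  have st: "theta powr t = s" using s theta_gt1 by (simp add: t_def)
  define v where "v = (\<chi> i. u $ i powr t)"
  have v: "v $ i > 0" for i using u(1)[of i] by (simp add: v_def)
  \<comment> \<open>The terms \<open>A k $ i $ j * a i k j\<close> sum to 1 over k and j, as
    \<open>u\<close> is an eigenvector; \<open>a i k j powr t\<close> is the same ratio for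
    \<open>v\<close> at \<open>s\<close>.\<close>
  define a where "a = (\<lambda>i k j. theta ^ k * u $ j / (theta * u $ i))"
  have a: "a i k j > 0" for i k j using u(1) theta_gt1 by (simp add: a_def)
  have a_powr: "a i k j powr t = s ^ k * v $ j / (s * v $ i)" for i k j
  proof -
    have "(theta ^ k) powr t = s ^ k"
      using theta_gt1 by (simp add: powr_realpow[symmetric] powr_powr mult.commute st[symmetric])
    thus ?thesis
      using theta_gt1 u(1)[of i] u(1)[of j]
      by (simp add: a_def powr_divide powr_mult st v_def less_imp_le)
  qed
  \<comment> \<open>\<open>D\<close> is the AM-GM defect of one entry of one \<open>A k\<close>;
    \<open>m\<close> below is its sum over k.\<close>
  define D where "D = (\<lambda>i k j. A k $ i $ j * (t * a i k j + (1 - t)) - A k $ i $ j * a i k j powr t)"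
  have D_nonneg: "D i k j \<ge> 0" for i k j
    unfolding D_def using powr_le_weighted(1)[OF a t] A_nonneg
    by (simp add: mult_left_mono)
  have D_eq_0: "a i k j = 1" if "D i k j = 0" "A k $ i $ j > 0" for i k j
    using powr_le_weighted(2)[OF a t, of i k j] that by (simp add: D_def)
  define m where "m = (\<lambda>i j. t * (real_powser_mat A theta $ i $ j * u $ j / (theta * u $ i))
     + (1 - t) * msum A $ i $ j - real_powser_mat A s $ i $ j * v $ j / (s * v $ i))"
  have D_sums: "(\<lambda>k. D i k j) sums m i j" for i j
  proof -
    have "(\<lambda>k. t * ((theta ^ k * A k $ i $ j) * u $ j / (theta * u $ i)) + (1 - t) * A k $ i $ j
            - (s ^ k * A k $ i $ j) * v $ j / (s * v $ i)) sums m i j"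
      unfolding m_def
      by (intro sums_diff sums_add sums_mult sums_divide sums_mult2 A_sums_msum sums_real_powser_mat
            lt_conv_radius) (use s in auto)
    moreover have "D i k j = t * ((theta ^ k * A k $ i $ j) * u $ j / (theta * u $ i)) + (1 - t) * A k $ i $ j
            - (s ^ k * A k $ i $ j) * v $ j / (s * v $ i)" for k
      unfolding D_def a_powr by (simp add: a_def algebra_simps)
    ultimately show ?thesis by simp
  qed
  \<comment> \<open>The first two parts of \<open>m\<close> contribute t, by the eigenvector
    equation at \<open>theta\<close>, and 1 - t, by the row sums of \<open>msum A\<close>.\<close>
  have m_sum: "(\<Sum>j\<in>UNIV. m i j) = 1 - (real_powser_mat A s *v v) $ i / (s * v $ i)" for i
  proof -
    have "(\<Sum>j\<in>UNIV. real_powser_mat A theta $ i $ j * u $ j) = theta * u $ i"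
      using arg_cong[OF u(2), of "\<lambda>w. w $ i"] by (simp add: matrix_vector_mult_def)
    thus ?thesis
      using u(1)[of i] theta_gt1 unfolding m_def
      by (simp add: sum_subtractf sum.distrib sum_distrib_left[symmetric] sum_divide_distrib[symmetric]
            msum_row matrix_vector_mult_def)
  qed
  have m_nonneg: "m i j \<ge> 0" for i j
    by (rule sums_le[OF _ sums_zero D_sums]) (rule D_nonneg)
  have sv: "s * v $ i > 0" for i using v[of i] s by simp
  have le: "(real_powser_mat A s *v v) $ i \<le> s * v $ i" for i
  proof -
    have "0 \<le> (\<Sum>j\<in>UNIV. m i j)" by (intro sum_nonneg m_nonneg)
    thus ?thesis using sv[of i] by (simp add: m_sum field_simps)
  qed
  have "\<exists>i. (real_powser_mat A s *v v) $ i \<noteq> s * v $ i"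
  proof (rule ccontr)
    \<comment> \<open>Equality in all rows makes all defects vanish, and the equality case of AM-GM
      is the excluded balance condition.\<close>
    assume "\<not> ?thesis"
    hence "(\<Sum>j\<in>UNIV. m i j) = 0" for i
      using less_imp_neq[OF sv[of i]] by (simp add: m_sum)
    hence m0: "m i j = 0" for i j
      using m_nonneg by (subst (asm) sum_nonneg_eq_0_iff) auto
    have "D i k j = 0" for i k j
      using suminf_eq_zero_iff[OF sums_summable[OF D_sums] D_nonneg] sums_unique[OF D_sums[of i j]] m0
      by simp
    hence "theta ^ k * u $ j = theta * u $ i" if "A k $ i $ j > 0" for i j k
      using D_eq_0[of i k j] that u(1)[of i] theta_gt1 by (simp add: a_def divide_eq_1_iff)
    thus False using not_all_balanced[OF u(1)] by blast
  qed
  then obtain i where "(real_powser_mat A s *v v) $ i \<noteq> s * v $ i" ..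
  with v le show ?thesis by (rule that)
qed

text \<open>A kernel vector is an eigenvector of \<open>Astar A z\<close> for the eigenvalue z. Its
  moduli are a subsolution at level |z|, which the maximum principle forbids next to a strict
  supersolution.\<close>

theorem det_mat_minus_Astar_nonzero:
  assumes z: "1 < cmod z" "cmod z < theta"
  shows "det (mat z - Astar A z) \<noteq> 0"
proof
  assume "det (mat z - Astar A z) = 0"
  hence "\<not> invertible (mat z - Astar A z)"
    by (simp add: invertible_det_nz)
  hence "\<not> (\<exists>N. N ** (mat z - Astar A z) = mat 1)"
    by (simp add: invertible_left_inverse)
  then obtain y where y: "y \<noteq> 0" "(mat z - Astar A z) *v y = 0"
    by (auto simp: matrix_left_invertible_ker)
  have "mat z *v y = z *s y"
    by (simp add: vec_eq_iff matrix_vector_mult_def mat_def if_distrib[of "\<lambda>c. c * _"] cong: if_cong)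
  with y(2) have y2: "Astar A z *v y = z *s y"
    unfolding matrix_vector_mult_diff_rdistrib by simp
  define s where "s = cmod z"
  obtain v i where v: "\<And>i. v $ i > 0" "\<And>i. (real_powser_mat A s *v v) $ i \<le> s * v $ i"
    "(real_powser_mat A s *v v) $ i \<noteq> s * v $ i"
    using strict_supersolution[of s] z unfolding s_def by metis
  have "cmod (Astar A z $ i $ j) \<le> real_powser_mat A s $ i $ j" for i j
    unfolding s_def by (rule cmod_Astar_le) (use A_nonneg lt_conv_radius z in auto)
  from eigenvector_cmod_subsolution[OF this y2]
  have sub: "s * cmod (y $ i) \<le> (real_powser_mat A s *v (\<chi> i. cmod (y $ i))) $ i" for i
    by (simp add: s_def)
  have "(real_powser_mat A s *v v) $ i = s * v $ i"
  proof (rule supersolution_with_subsolution_imp_eq[where w = "\<chi> i. cmod (y $ i)"])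
    show "(\<chi> i. cmod (y $ i)) \<noteq> 0" using y(1) by (auto simp: vec_eq_iff)
  qed (use v sub z in \<open>auto simp: s_def intro!: real_powser_mat_nonneg irreducible_real_powser_mat\<close>)
  with v(3) show False by simp
qed

end

subsection \<open>The stationary distribution\<close>

text \<open>Only the leading coefficient of \<open>F\<close> at \<open>rB\<close> is fixed here;
  those at other points of the circle enter with the asymptotics.\<close>

locale mg1_chain = mg1_kernel A pi theta
  for A :: "nat \<Rightarrow> real^'m::finite^'m" and pi :: "real^'m" and theta :: real +
  fixes B0 :: "real^'p::finite^'p"
    and B :: "nat \<Rightarrow> real^'m^'p"
    and C0 :: "real^'p^'m"
    and x :: "('p, 'm) mg1_state \<Rightarrow> real"
    and rB :: real
    and mB :: nat
    and U :: "complex set"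
    and F :: "complex \<Rightarrow> complex^'m^'p"
    and Bt1 :: "complex^'m^'p"
  assumes B0_nonneg: "\<And>i j. B0 $ i $ j \<ge> 0"
    and B_nonneg: "\<And>k i j. B k $ i $ j \<ge> 0"
    and C0_nonneg: "\<And>i j. C0 $ i $ j \<ge> 0"
    and x_nonneg: "\<And>s. s \<in> mg1_states \<Longrightarrow> x s \<ge> 0"
    and x_prob: "(x has_sum 1) mg1_states"
    and x_stat: "\<And>t. t \<in> mg1_states \<Longrightarrow>
                   ((\<lambda>s. x s * mg1_T A B0 B C0 s t) has_sum x t) mg1_states"
    and T_irred: "irreducible_on mg1_states (mg1_T A B0 B C0)"
    and rB_def: "conv_radius B = ereal rB"
    and rB_gt1: "rB > 1"
    and theta_gt_rB: "theta > rB"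
    and U_open: "open U"
    and U_disc: "cball 0 rB \<subseteq> U"
    and F_mero: "\<And>i j. (\<lambda>z. F z $ i $ j) meromorphic_on U"
    and F_ext: "\<And>z. z \<in> ball 0 rB \<Longrightarrow> F z = Bstar B z"
    and mB_pos: "mB \<ge> 1"
    and Bt_lim1: "((\<lambda>z. \<chi> i j. (1 - z / complex_of_real rB) ^ mB * F z $ i $ j)
                    \<longlongrightarrow> Bt1) (at (complex_of_real rB))"
    and Bt1_nonneg: "\<And>i j. Im (Bt1 $ i $ j) = 0 \<and> Re (Bt1 $ i $ j) \<ge> 0"
    and Bt1_nz: "Bt1 \<noteq> 0"
begin

lemma mg1_T_nonneg: "mg1_T A B0 B C0 s t \<ge> 0"
  by (cases s; cases t) (auto simp: A_nonneg B0_nonneg B_nonneg C0_nonneg)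

text \<open>Total mass 1 gives one state of positive mass, and stationarity passes positivity along
  every positive transition.\<close>

lemma x_pos:
  assumes "t \<in> mg1_states"
  shows "x t > 0"
proof -
  obtain s where s: "s \<in> mg1_states" "x s > 0"
  proof (rule ccontr)
    assume "\<not> thesis"
    hence "x s = 0" if "s \<in> mg1_states" for s
      using x_nonneg[OF that] that \<open>\<And>s. s \<in> mg1_states \<Longrightarrow> 0 < x s \<Longrightarrow> thesis\<close> by force
    hence "(x has_sum 0) mg1_states" by (rule has_sum_0)
    thus False using x_prob has_sum_unique by fastforce
  qed
  have step: "x v > 0" if "u \<in> mg1_states" "v \<in> mg1_states" "mg1_T A B0 B C0 u v > 0" "x u > 0" for u v
  proof -
    have "x u * mg1_T A B0 B C0 u v \<le> x v"
    proof (rule has_sum_mono_neutral)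
      show "((\<lambda>s. x s * mg1_T A B0 B C0 s v) has_sum (x u * mg1_T A B0 B C0 u v)) {u}"
        by (rule has_sum_finiteI) auto
      show "((\<lambda>s. x s * mg1_T A B0 B C0 s v) has_sum x v) mg1_states"
        using that by (intro x_stat)
    qed (use that x_nonneg mg1_T_nonneg in auto)
    moreover have "x u * mg1_T A B0 B C0 u v > 0" using that by simp
    ultimately show ?thesis by linarith
  qed
  have "(s, t) \<in> {(u, v). u \<in> mg1_states \<and> v \<in> mg1_states \<and> mg1_T A B0 B C0 u v > 0}\<^sup>*"
    using T_irred s assms unfolding irreducible_on_def by blast
  thus ?thesis
    by (induction rule: rtrancl_induct) (use s step in auto)
qed

text \<open>Level 0 has its own phase type and enters separately through \<open>x (L0 i)\<close>.
  The value 0 in its place makes the generating function start at the first power.\<close>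

definition lev :: "nat \<Rightarrow> 'm \<Rightarrow> real" where
  "lev k j = (if k = 0 then 0 else x (Lk k j))"

lemma lev_nonneg: "lev k j \<ge> 0"
  by (auto simp: lev_def mg1_states_def intro!: x_nonneg)

lemma lev_summable: "summable (\<lambda>k. lev k j)"
proof -
  have "x summable_on (\<lambda>k. Lk (Suc k) j) ` UNIV"
    by (rule summable_on_subset_banach[of _ mg1_states])
       (use x_prob in \<open>auto simp: mg1_states_def summable_on_def\<close>)
  hence "(\<lambda>k. x (Lk (Suc k) j)) summable_on UNIV"
    by (subst (asm) summable_on_reindex) (auto simp: inj_on_def o_def)
  hence "summable (\<lambda>k. x (Lk (Suc k) j))"
    by (meson has_sum_imp_sums sums_summable summable_on_def)
  hence "summable (\<lambda>k. lev (Suc k) j)"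
    by (simp add: lev_def)
  thus ?thesis by (subst (asm) summable_Suc_iff)
qed

text \<open>The chain descends at most one level per step, so only level 0 and levels up to l + 1
  feed level l. The zero term k = 0 is kept to give the convolution of a Cauchy product.\<close>

lemma lev_stationary:
  assumes "l \<ge> 1"
  shows "lev l j = (\<Sum>i\<in>UNIV. x (L0 i) * B l $ i $ j)
           + (\<Sum>i\<in>UNIV. \<Sum>k\<le>Suc l. lev k i * A (Suc l - k) $ i $ j)"
proof -
  define S :: "('p, 'm) mg1_state set" where "S = range L0 \<union> (\<lambda>(i, k). Lk k i) ` (UNIV \<times> {1..Suc l})"
  have "((\<lambda>s. x s * mg1_T A B0 B C0 s (Lk l j)) has_sum x (Lk l j)) mg1_states"
    by (rule x_stat) (use assms in \<open>auto simp: mg1_states_def\<close>)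
  also have "?this \<longleftrightarrow> ((\<lambda>s. x s * mg1_T A B0 B C0 s (Lk l j)) has_sum x (Lk l j)) S"
    by (rule has_sum_cong_neutral) (auto simp: mg1_states_def S_def image_iff split: if_splits)
  finally have "((\<lambda>s. x s * mg1_T A B0 B C0 s (Lk l j)) has_sum x (Lk l j)) S" .
  moreover have fin: "finite S" by (auto simp: S_def)
  ultimately have "x (Lk l j) = (\<Sum>s\<in>S. x s * mg1_T A B0 B C0 s (Lk l j))"
    using has_sum_unique has_sum_finite by blast
  also have "\<dots> = (\<Sum>s\<in>range L0. x s * mg1_T A B0 B C0 s (Lk l j))
      + (\<Sum>s\<in>(\<lambda>(i, k). Lk k i) ` (UNIV \<times> {1..Suc l}). x s * mg1_T A B0 B C0 s (Lk l j))"
    unfolding S_def by (rule sum.union_disjoint) auto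
  also have "(\<Sum>s\<in>range L0. x s * mg1_T A B0 B C0 s (Lk l j)) = (\<Sum>i\<in>UNIV. x (L0 i) * B l $ i $ j)"
    by (subst sum.reindex) (auto simp: inj_on_def)
  also have "(\<Sum>s\<in>(\<lambda>(i, k). Lk k i) ` (UNIV \<times> {1..Suc l}). x s * mg1_T A B0 B C0 s (Lk l j)) =
      (\<Sum>(i, k)\<in>UNIV \<times> {1..Suc l}. x (Lk k i) * A (Suc l - k) $ i $ j)"
    by (subst sum.reindex) (auto simp: inj_on_def intro!: sum.cong)
  also have "\<dots> = (\<Sum>i\<in>UNIV. \<Sum>k\<in>{1..Suc l}. x (Lk k i) * A (Suc l - k) $ i $ j)"
    by (rule sum.cartesian_product[symmetric])
  also have "\<dots> = (\<Sum>i\<in>UNIV. \<Sum>k\<le>Suc l. lev k i * A (Suc l - k) $ i $ j)"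
  proof (rule sum.cong[OF refl])
    fix i
    have "(\<Sum>k\<le>Suc l. lev k i * A (Suc l - k) $ i $ j) = (\<Sum>k\<in>{1..Suc l}. lev k i * A (Suc l - k) $ i $ j)"
      by (rule sum.mono_neutral_right) (auto simp: lev_def)
    thus "(\<Sum>k\<in>{1..Suc l}. x (Lk k i) * A (Suc l - k) $ i $ j) =
          (\<Sum>k\<le>Suc l. lev k i * A (Suc l - k) $ i $ j)"
      by (simp add: lev_def)
  qed
  finally show ?thesis using assms by (simp add: lev_def)
qed

definition X :: "complex \<Rightarrow> complex^'m" where
  "X z = (\<chi> j. \<Sum>k. of_real (lev k j) * z ^ k)"

lemma summable_norm_X:
  assumes "cmod z \<le> 1"
  shows "summable (\<lambda>k. norm (of_real (lev k j) * z ^ k))"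
proof (rule summable_comparison_test'[OF lev_summable[of j]])
  fix k
  show "norm (norm (of_real (lev k j) * z ^ k)) \<le> lev k j"
    using assms lev_nonneg[of k j]
    by (simp add: norm_mult norm_power power_le_one mult_left_le)
qed

lemma X_sums: "cmod z \<le> 1 \<Longrightarrow> (\<lambda>k. of_real (lev k j) * z ^ k) sums X z $ j"
  using summable_norm_X[of z j] by (auto simp: X_def dest: summable_norm_cancel)

lemma cmod_X_le: "cmod z \<le> 1 \<Longrightarrow> cmod (X z $ j) \<le> (\<Sum>k. lev k j)"
proof -
  assume z: "cmod z \<le> 1"
  have "cmod (X z $ j) \<le> (\<Sum>k. norm (of_real (lev k j) * z ^ k))"
    unfolding X_def using summable_norm[OF summable_norm_X[OF z]] by simp
  also have "\<dots> \<le> (\<Sum>k. lev k j)"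
  proof (rule suminf_le[OF _ summable_norm_X[OF z] lev_summable])
    show "norm (of_real (lev k j) * z ^ k) \<le> lev k j" for k
      using z lev_nonneg[of k j] by (simp add: norm_mult norm_power power_le_one mult_left_le)
  qed
  finally show ?thesis .
qed

lemma Bstar_sums:
  assumes "cmod z < rB"
  shows "(\<lambda>k. of_real (B (Suc k) $ i $ j) * z ^ Suc k) sums Bstar B z $ i $ j"
proof -
  have "summable (\<lambda>k. z ^ k * of_real (B k $ i $ j))"
    by (rule summable_norm_cancel, rule summable_powser_entry) (use assms rB_def in simp)
  hence "summable (\<lambda>k. z ^ Suc k * of_real (B (Suc k) $ i $ j))"
    by (subst summable_Suc_iff)
  thus ?thesis
    unfolding Bstar_def by (simp add: summable_sums mult.commute[of "of_real _"])
qed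

lemma Astar_sums:
  assumes "cmod z \<le> theta"
  shows "(\<lambda>k. of_real (A k $ i $ j) * z ^ k) sums Astar A z $ i $ j"
proof -
  have "summable (\<lambda>k. z ^ k * of_real (A k $ i $ j))"
    by (rule summable_norm_cancel, rule summable_powser_entry) (use assms lt_conv_radius in simp)
  thus ?thesis
    unfolding Astar_def by (simp add: summable_sums mult.commute[of "of_real _"])
qed

text \<open>Written with \<open>F\<close>, so that it makes sense beyond \<open>rB\<close>. The
  subtracted part is the coefficient of z in X(z) times \<open>Astar A z\<close>, which no balance
  equation of a level l \<ge> 1 accounts for.\<close>

definition rhs :: "complex \<Rightarrow> complex^'m" where
  "rhs z = (\<chi> j. z * ((\<Sum>i\<in>UNIV. of_real (x (L0 i)) * F z $ i $ j)
                     - (\<Sum>i\<in>UNIV. of_real (lev 1 i * A 0 $ i $ j))))"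

lemma X_equation:
  assumes z: "cmod z < 1"
  shows "X z v* (mat z - Astar A z) = rhs z"
proof -
  have "(\<Sum>i\<in>UNIV. X z $ i * Astar A z $ i $ j) = z * X z $ j - rhs z $ j" for j
  proof -
    define c where "c = (\<lambda>n. \<Sum>i\<in>UNIV. \<Sum>k\<le>n. lev k i * A (n - k) $ i $ j)"
    have prod: "(\<lambda>n. \<Sum>k\<le>n. (of_real (lev k i) * z ^ k) * (of_real (A (n - k) $ i $ j) * z ^ (n - k)))
            sums (X z $ i * Astar A z $ i $ j)" for i
    proof -
      have "summable (\<lambda>k. norm (of_real (A k $ i $ j) * z ^ k))"
        using summable_powser_entry[of z A i j] lt_conv_radius[of "cmod z"] z theta_gt1
        by (simp add: mult.commute)
      from Cauchy_product_sums[OF summable_norm_X[of z i] this] show ?thesis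
        using X_sums[of z i] Astar_sums[of z i j] z theta_gt1 by (simp add: sums_iff)
    qed
    have "(\<lambda>n. \<Sum>i\<in>UNIV. \<Sum>k\<le>n. (of_real (lev k i) * z ^ k) * (of_real (A (n - k) $ i $ j) * z ^ (n - k)))
            sums (\<Sum>i\<in>UNIV. X z $ i * Astar A z $ i $ j)"
      by (rule sums_sum) (rule prod)
    also have "(\<lambda>n. \<Sum>i\<in>UNIV. \<Sum>k\<le>n. (of_real (lev k i) * z ^ k) * (of_real (A (n - k) $ i $ j) * z ^ (n - k)))
        = (\<lambda>n. of_real (c n) * z ^ n)"
      unfolding c_def of_real_sum sum_distrib_right
      by (intro ext sum.cong refl) (simp add: power_add[symmetric] mult_ac flip: power_add)
    finally have 1: "(\<lambda>n. of_real (c n) * z ^ n) sums (\<Sum>i\<in>UNIV. X z $ i * Astar A z $ i $ j)" .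
    \<comment> \<open>Coefficient n of the product belongs to level n - 1: index 0 vanishes, index 1
      is the correction in \<open>rhs\<close>, and the balance equations start at index 2.\<close>
    have c0: "c 0 = 0" by (simp add: c_def lev_def)
    have c1: "c (Suc 0) = (\<Sum>i\<in>UNIV. lev 1 i * A 0 $ i $ j)" by (simp add: c_def lev_def)
    have c2: "c (Suc (Suc l)) = lev (Suc l) j - (\<Sum>i\<in>UNIV. x (L0 i) * B (Suc l) $ i $ j)" for l
      using lev_stationary[of "Suc l" j] by (simp add: c_def)
    have "(\<lambda>l. of_real (lev (Suc l) j) * z ^ Suc l) sums X z $ j"
      using X_sums[of z j] z by (subst sums_Suc_iff) (simp add: lev_def)
    moreover have "(\<lambda>l. \<Sum>i\<in>UNIV. of_real (x (L0 i)) * (of_real (B (Suc l) $ i $ j) * z ^ Suc l))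
        sums (\<Sum>i\<in>UNIV. of_real (x (L0 i)) * Bstar B z $ i $ j)"
      by (intro sums_sum sums_mult Bstar_sums) (use z rB_gt1 in auto)
    ultimately have "(\<lambda>l. z * (of_real (lev (Suc l) j) * z ^ Suc l
          - (\<Sum>i\<in>UNIV. of_real (x (L0 i)) * (of_real (B (Suc l) $ i $ j) * z ^ Suc l))))
        sums (z * (X z $ j - (\<Sum>i\<in>UNIV. of_real (x (L0 i)) * Bstar B z $ i $ j)))"
      by (intro sums_mult sums_diff)
    also have "(\<lambda>l. z * (of_real (lev (Suc l) j) * z ^ Suc l
          - (\<Sum>i\<in>UNIV. of_real (x (L0 i)) * (of_real (B (Suc l) $ i $ j) * z ^ Suc l)))) =
        (\<lambda>l. of_real (c (Suc (Suc l))) * z ^ Suc (Suc l))"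
      by (intro ext) (simp add: c2 right_diff_distrib left_diff_distrib sum_distrib_left sum_distrib_right mult_ac)
    finally have "(\<lambda>n. of_real (c (Suc n)) * z ^ Suc n) sums
        (z * (X z $ j - (\<Sum>i\<in>UNIV. of_real (x (L0 i)) * Bstar B z $ i $ j)) + of_real (c (Suc 0)) * z)"
      using sums_Suc_iff[of "\<lambda>n. of_real (c (Suc n)) * z ^ Suc n"] by simp
    hence "(\<lambda>n. of_real (c n) * z ^ n) sums
        (z * (X z $ j - (\<Sum>i\<in>UNIV. of_real (x (L0 i)) * Bstar B z $ i $ j)) + of_real (c (Suc 0)) * z)"
      using sums_Suc_iff[of "\<lambda>n. of_real (c n) * z ^ n"] c0 by simp
    with 1 have "(\<Sum>i\<in>UNIV. X z $ i * Astar A z $ i $ j) =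
        z * (X z $ j - (\<Sum>i\<in>UNIV. of_real (x (L0 i)) * Bstar B z $ i $ j)) + of_real (c (Suc 0)) * z"
      by (rule sums_unique2)
    moreover have "F z = Bstar B z" by (rule F_ext) (use z rB_gt1 in auto)
    ultimately show ?thesis
      by (simp add: rhs_def c1 algebra_simps)
  qed
  moreover have "(X z v* mat z) $ j = z * X z $ j" for j
    by (simp add: vector_matrix_mult_def mat_def if_distrib[of "\<lambda>c. _ * c"] cong: if_cong)
  ultimately show ?thesis
    by (simp add: vec_eq_iff vector_matrix_mult_def right_diff_distrib sum_subtractf)
qed

end

subsection \<open>Meromorphic continuation\<close>

lemma analytic_on_det:
  fixes M :: "complex \<Rightarrow> complex^'n::finite^'n"
  assumes "\<And>i j. (\<lambda>z. M z $ i $ j) analytic_on S"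
  shows "(\<lambda>z. det (M z)) analytic_on S"
  unfolding det_def by (intro analytic_on_sum analytic_on_mult analytic_on_const analytic_on_prod assms)

lemma meromorphic_on_det:
  fixes M :: "complex \<Rightarrow> complex^'n::finite^'n"
  assumes "\<And>i j. (\<lambda>z. M z $ i $ j) meromorphic_on S"
  shows "(\<lambda>z. det (M z)) meromorphic_on S"
  unfolding det_def by (intro meromorphic_on_sum meromorphic_on_mult meromorphic_on_const meromorphic_on_prod assms)

lemma tendsto_det:
  fixes M :: "'a \<Rightarrow> complex^'n::finite^'n"
  assumes "\<And>i j. ((\<lambda>z. M z $ i $ j) \<longlongrightarrow> L $ i $ j) Fl"
  shows "((\<lambda>z. det (M z)) \<longlongrightarrow> det L) Fl"
  unfolding det_def by (intro tendsto_intros assms)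

text \<open>The unknown of \<open>y v* M = b\<close> is a row vector, so \<open>b\<close> replaces a
  row of the matrix.\<close>

definition cramer_num :: "complex^'n^'n \<Rightarrow> complex^'n \<Rightarrow> 'n::finite \<Rightarrow> complex" where
  "cramer_num M b k = det (\<chi> i. if i = k then b else M $ i)"

lemma cramer_num_eq:
  assumes "y v* M = b"
  shows "cramer_num M b k = y $ k * det M"
proof -
  have "b = (\<Sum>i\<in>UNIV. y $ i *s row i M)"
    using assms by (auto simp: vec_eq_iff vector_matrix_mult_def row_def sum_component mult_ac)
  moreover have "row i M = M $ i" for i
    by (simp add: row_def vec_eq_iff)
  ultimately show ?thesis
    using cramer_lemma_transpose[of k y M] by (simp add: cramer_num_def cong: if_cong)
qed

lemma cramer_num_scale: "cramer_num M (c *s b) k = c * cramer_num M b k"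
  unfolding cramer_num_def by (rule det_row_mul)

lemma tendsto_cramer_num:
  assumes "\<And>i j. ((\<lambda>z. M z $ i $ j) \<longlongrightarrow> L $ i $ j) Fl" "\<And>j. ((\<lambda>z. b z $ j) \<longlongrightarrow> c $ j) Fl"
  shows "((\<lambda>z. cramer_num (M z) (b z) k) \<longlongrightarrow> cramer_num L c k) Fl"
  unfolding cramer_num_def
proof (rule tendsto_det)
  fix i j
  show "((\<lambda>z. (\<chi> i. if i = k then b z else M z $ i) $ i $ j) \<longlongrightarrow> (\<chi> i. if i = k then c else L $ i) $ i $ j) Fl"
    using assms by (cases "i = k") auto
qed

lemma analytic_on_cramer_num:
  assumes "\<And>i j. (\<lambda>z. M z $ i $ j) analytic_on S" "\<And>j. (\<lambda>z. b z $ j) analytic_on S"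
  shows "(\<lambda>z. cramer_num (M z) (b z) k) analytic_on S"
  unfolding cramer_num_def
proof (rule analytic_on_det)
  fix i j
  show "(\<lambda>z. (\<chi> i. if i = k then b z else M z $ i) $ i $ j) analytic_on S"
    using assms by (cases "i = k") auto
qed

lemma meromorphic_on_cramer_num:
  assumes "\<And>i j. (\<lambda>z. M z $ i $ j) meromorphic_on S" "\<And>j. (\<lambda>z. b z $ j) meromorphic_on S"
  shows "(\<lambda>z. cramer_num (M z) (b z) k) meromorphic_on S"
  unfolding cramer_num_def
proof (rule meromorphic_on_det)
  fix i j
  show "(\<lambda>z. (\<chi> i. if i = k then b z else M z $ i) $ i $ j) meromorphic_on S"
    using assms by (cases "i = k") auto
qed

lemma filterlim_at_infinity_imp_not_bounded:
  fixes f :: "'a \<Rightarrow> 'b::real_normed_vector"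
  assumes "filterlim f at_infinity Fl" "eventually (\<lambda>z. norm (f z) \<le> K) Fl" "Fl \<noteq> bot"
  shows False
proof -
  have "filterlim (\<lambda>z. norm (f z)) at_top Fl"
    using assms(1) by (rule filterlim_at_infinity_imp_norm_at_top)
  hence "eventually (\<lambda>z. norm (f z) > K) Fl"
    by (auto simp: filterlim_at_top_dense)
  with assms(2) have "eventually (\<lambda>z. False) Fl"
    by eventually_elim simp
  thus False using assms(3) by simp
qed

text \<open>Compactness gives a uniform margin \<open>e\<close>; a point of the extra ring of width
  \<open>e / 2\<close> lies within \<open>e\<close> of its radial projection to the ball.\<close>

lemma cball_subset_open_enlarge:
  fixes U :: "'a::euclidean_space set"
  assumes "open U" "cball 0 r \<subseteq> U" "r > 0"
  obtains R where "r < R" "cball 0 R \<subseteq> U"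
proof -
  obtain e where e: "e > 0" "(\<Union>x\<in>cball 0 r. ball x e) \<subseteq> U"
    using compact_subset_open_imp_ball_epsilon_subset[of "cball 0 r" U] assms by auto
  have "z \<in> U" if "norm z \<le> r + e / 2" for z
  proof (cases "norm z \<le> r")
    case True
    thus ?thesis using assms by auto
  next
    case False
    hence z: "norm z > 0" using assms by linarith
    define y where "y = (r / norm z) *\<^sub>R z"
    have "y - z = (r / norm z - 1) *\<^sub>R z" by (simp add: y_def scaleR_diff_left)
    hence "dist y z = \<bar>r / norm z - 1\<bar> * norm z" by (simp add: dist_norm)
    also have "\<dots> = norm z - r" using z False by (simp add: abs_if field_simps)
    also have "\<dots> < e" using that e by linarith
    finally have "z \<in> ball y e" by simp
    moreover have "y \<in> cball 0 r" using z assms by (simp add: y_def)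
    ultimately show ?thesis using e by blast
  qed
  thus ?thesis using e by (intro that[of "r + e / 2"]) auto
qed

context mg1_chain
begin

lemma Astar_analytic: "(\<lambda>z. Astar A z $ i $ j) analytic_on ball 0 theta"
proof -
  have "(\<lambda>z. Astar A z $ i $ j) holomorphic_on ball 0 theta"
    by (rule power_series_holomorphic[where a = "\<lambda>k. of_real (A k $ i $ j)"])
       (use Astar_sums in auto)
  thus ?thesis by (simp add: analytic_on_open)
qed

lemma Bstar_analytic: "(\<lambda>z. Bstar B z $ i $ j) analytic_on ball 0 rB"
proof -
  have "(\<lambda>z. Bstar B z $ i $ j) holomorphic_on ball 0 rB"
  proof (rule power_series_holomorphic[where a = "\<lambda>k. if k = 0 then 0 else of_real (B k $ i $ j)"])
    fix w :: complex assume "w \<in> ball 0 rB"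
    hence "(\<lambda>k. of_real (B (Suc k) $ i $ j) * w ^ Suc k) sums Bstar B w $ i $ j"
      using Bstar_sums[of w i j] by simp
    thus "(\<lambda>n. (if n = 0 then 0 else of_real (B n $ i $ j)) * (w - 0) ^ n) sums Bstar B w $ i $ j"
      using sums_Suc_iff[of "\<lambda>n. (if n = 0 then 0 else of_real (B n $ i $ j)) * (w - 0) ^ n"] by simp
  qed
  thus ?thesis by (simp add: analytic_on_open)
qed

lemma F_analytic_ball: "(\<lambda>z. F z $ i $ j) analytic_on ball 0 rB"
proof -
  have "(\<lambda>z. F z $ i $ j) holomorphic_on ball 0 rB"
    by (rule holomorphic_transform[OF analytic_imp_holomorphic[OF Bstar_analytic[of i j]]])
       (simp add: F_ext)
  thus ?thesis by (simp add: analytic_on_open)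
qed

text \<open>Singularities of a meromorphic function do not accumulate in \<open>U\<close>, so a
  slightly larger disc holds finitely many. None is inside \<open>ball 0 rB\<close>, and
  \<open>R\<close> does not exceed the modulus of any beyond the circle.\<close>

lemma F_poles:
  "\<exists>P R. finite P \<and> P \<subseteq> sphere 0 rB \<and> rB < R \<and> R < theta \<and>
     (\<forall>i j. (\<lambda>z. F z $ i $ j) analytic_on ball 0 R - P)"
proof -
  obtain R1 where R1: "rB < R1" "cball 0 R1 \<subseteq> U"
    using cball_subset_open_enlarge[OF U_open U_disc] rB_gt1 by auto
  define bad where "bad = (\<lambda>i j. {w. \<not> (\<lambda>z. F z $ i $ j) analytic_on {w}})"
  have "finite (cball 0 R1 \<inter> bad i j)" for i j
  proof (rule ccontr)
    assume inf: "infinite (cball 0 R1 \<inter> bad i j)"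
    have "compact (cball (0::complex) R1)" by simp
    then obtain p where p: "p \<in> cball 0 R1" "p islimpt (cball 0 R1 \<inter> bad i j)"
      using inf Heine_Borel_imp_Bolzano_Weierstrass[of "cball 0 R1"] by blast
    have "\<not> p islimpt bad i j"
      unfolding bad_def using meromorphic_on_imp_not_islimpt_singularities[OF F_mero] p R1 by blast
    thus False using p(2) islimpt_subset by blast
  qed
  hence fin_bad: "finite (\<Union>i. \<Union>j. cball 0 R1 \<inter> bad i j)"
    by (intro finite_UN_I) auto
  define Q where "Q = (\<Union>i. \<Union>j. cball 0 R1 \<inter> bad i j)"
  have finQ: "finite Q" unfolding Q_def by (rule fin_bad)
  \<comment> \<open>The midpoint of \<open>rB\<close> and \<open>theta\<close> keeps
    \<open>R\<close> below \<open>theta\<close>.\<close>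
  define R where "R = Min (insert (min R1 ((rB + theta) / 2)) (norm ` {q \<in> Q. norm q > rB}))"
  have fin: "finite (insert (min R1 ((rB + theta) / 2)) (norm ` {q \<in> Q. norm q > rB}))"
    using finQ by simp
  have "rB < R"
    unfolding R_def using fin R1 theta_gt_rB by (subst Min_gr_iff) auto
  moreover have "R \<le> min R1 ((rB + theta) / 2)"
    unfolding R_def using fin by (intro Min_le) auto
  hence R_le: "R \<le> R1" "R < theta" using theta_gt_rB by auto
  moreover have "(\<lambda>z. F z $ i $ j) analytic_on ball 0 R - Q \<inter> sphere 0 rB" for i j
  proof (subst analytic_on_analytic_at, rule ballI, rule ccontr)
    fix z assume z: "z \<in> ball 0 R - Q \<inter> sphere 0 rB" "\<not> (\<lambda>z. F z $ i $ j) analytic_on {z}"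
    have zQ: "z \<in> Q" using z R_le by (auto simp: Q_def bad_def)
    have "\<not> z \<in> ball 0 rB"
      using F_analytic_ball[of i j] z(2) analytic_on_analytic_at by blast
    hence "norm z > rB" using z(1) zQ by auto
    hence "R \<le> norm z" unfolding R_def using fin zQ by (intro Min_le) auto
    thus False using z(1) by auto
  qed
  ultimately show ?thesis
    using finQ by (intro exI[of _ "Q \<inter> sphere 0 rB"] exI[of _ R]) auto
qed

lemma cmod_Bstar_le:
  assumes "cmod z < rB"
  shows "cmod (Bstar B z $ i $ j) \<le> cmod (Bstar B (of_real (cmod z)) $ i $ j)"
proof -
  have 1: "(\<lambda>k. of_real (B (Suc k) $ i $ j) * complex_of_real (cmod z) ^ Suc k)
             sums Bstar B (of_real (cmod z)) $ i $ j"
    by (rule Bstar_sums) (use assms in simp)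
  have 2: "(\<lambda>k. B (Suc k) $ i $ j * cmod z ^ Suc k) sums Re (Bstar B (of_real (cmod z)) $ i $ j)"
    using sums_Re[OF 1] by (simp del: power_Suc flip: of_real_power of_real_mult)
  have "cmod (Bstar B z $ i $ j) \<le> Re (Bstar B (of_real (cmod z)) $ i $ j)"
  proof (rule norm_sums_le[OF Bstar_sums[OF assms] 2])
    show "norm (of_real (B (Suc k) $ i $ j) * z ^ Suc k) \<le> B (Suc k) $ i $ j * cmod z ^ Suc k" for k
      using B_nonneg by (simp add: norm_mult norm_power)
  qed
  also have "\<dots> \<le> cmod (Bstar B (of_real (cmod z)) $ i $ j)" by (rule complex_Re_le_cmod)
  finally show ?thesis .
qed

text \<open>Since \<open>B\<close> is nonnegative, no pole of \<open>F\<close> on the circle exceeds the order of the pole at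
  \<open>rB\<close>.\<close>

lemma F_limit_exists:
  assumes p: "cmod p = rB"
  shows "\<exists>L. (\<lambda>z. \<chi> i j. (1 - z / p) ^ mB * F z $ i $ j) \<midarrow>p\<rightarrow> (L :: complex^'m^'p)"
proof -
  have p0: "p \<noteq> 0" using p rB_gt1 by auto
  have "\<exists>l. (\<lambda>z. (1 - z / p) ^ mB * F z $ i $ j) \<midarrow>p\<rightarrow> l" for i j
  proof -
    define \<phi> where "\<phi> = (\<lambda>z. (1 - z / p) ^ mB * F z $ i $ j)"
    have "p \<in> U" using U_disc p by auto
    hence "(\<lambda>z. F z $ i $ j) meromorphic_on {p}"
      using F_mero[of i j] meromorphic_on_subset by blast
    hence "\<phi> meromorphic_on {p}"
      unfolding \<phi>_def by (intro meromorphic_intros) (use p0 in auto)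
    hence "not_essential \<phi> p" by (rule meromorphic_on_not_essential)
    moreover have "\<not> is_pole \<phi> p"
    proof
      assume "is_pole \<phi> p"
      \<comment> \<open>A pole would show on the radius towards \<open>p\<close>. There the factor
        is \<open>(1 - t) ^ mB\<close>, the same as on the radius towards \<open>rB\<close>, where
        the product stays bounded.\<close>
      have path: "filterlim (\<lambda>t. complex_of_real t * q) (at q) (at_left 1)" if "q \<noteq> 0" for q
        unfolding filterlim_at
      proof
        show "eventually (\<lambda>t. complex_of_real t * q \<in> UNIV \<and> complex_of_real t * q \<noteq> q) (at_left 1)"
          using that by (auto simp: eventually_at_filter)
        have "((\<lambda>t. complex_of_real t * q) \<longlongrightarrow> complex_of_real 1 * q) (at_left 1)"
          by (intro tendsto_intros)
        thus "((\<lambda>t. complex_of_real t * q) \<longlongrightarrow> q) (at_left 1)" by simp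
      qed
      have inf: "filterlim (\<lambda>t. \<phi> (of_real t * p)) at_infinity (at_left 1)"
        using filterlim_compose[OF \<open>is_pole \<phi> p\<close>[unfolded is_pole_def] path[OF p0]] .
      have "((\<lambda>z. (1 - z / of_real rB) ^ mB * F z $ i $ j) \<longlongrightarrow> Bt1 $ i $ j) (at (of_real rB))"
        using tendsto_vec_nth[OF tendsto_vec_nth[OF Bt_lim1, of i], of j] by simp
      from filterlim_compose[OF this path[of "of_real rB"]] rB_gt1
      have "((\<lambda>t. (1 - complex_of_real t) ^ mB * F (of_real t * of_real rB) $ i $ j) \<longlongrightarrow> Bt1 $ i $ j) (at_left 1)"
        by simp
      hence "eventually (\<lambda>t. norm ((1 - complex_of_real t) ^ mB * F (of_real t * of_real rB) $ i $ j)
               < norm (Bt1 $ i $ j) + 1) (at_left 1)"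
        by (intro order_tendstoD(2)[OF tendsto_norm]) auto
      moreover have "eventually (\<lambda>t::real. 0 < t \<and> t < 1) (at_left 1)"
        using eventually_at_left_real[of 0 1] by (auto elim: eventually_mono)
      ultimately have "eventually (\<lambda>t. norm (\<phi> (of_real t * p)) \<le> norm (Bt1 $ i $ j) + 1) (at_left 1)"
      proof eventually_elim
        case (elim t)
        have tr: "t * rB < rB" using elim rB_gt1 by simp
        have *: "cmod (of_real t * p) = t * rB" using elim p by (simp add: norm_mult)
        have "norm (\<phi> (of_real t * p)) = cmod (1 - of_real t) ^ mB * cmod (F (of_real t * p) $ i $ j)"
          using p0 by (simp add: \<phi>_def norm_mult norm_power)
        also have "\<dots> \<le> cmod (1 - of_real t) ^ mB * cmod (F (of_real t * of_real rB) $ i $ j)"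
        proof (rule mult_left_mono)
          have "F (of_real t * p) = Bstar B (of_real t * p)"
            by (rule F_ext) (use * tr in \<open>simp add: mem_ball\<close>)
          moreover have "F (of_real t * of_real rB) = Bstar B (of_real (t * rB))"
            using F_ext[of "of_real (t * rB)"] elim tr rB_gt1 by (simp add: norm_mult)
          ultimately show "cmod (F (of_real t * p) $ i $ j) \<le> cmod (F (of_real t * of_real rB) $ i $ j)"
            using cmod_Bstar_le[of "of_real t * p" i j] * tr by simp
        qed simp
        also have "\<dots> = norm ((1 - complex_of_real t) ^ mB * F (of_real t * of_real rB) $ i $ j)"
          by (simp add: norm_mult norm_power)
        finally show ?case using elim by linarith
      qed
      from filterlim_at_infinity_imp_not_bounded[OF inf this] show False by simp
    qed
    ultimately show ?thesis by (auto simp: not_essential_def \<phi>_def)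
  qed
  then obtain l where l: "\<And>i j. (\<lambda>z. (1 - z / p) ^ mB * F z $ i $ j) \<midarrow>p\<rightarrow> l i j" by metis
  have "(\<lambda>z. \<chi> i j. (1 - z / p) ^ mB * F z $ i $ j) \<midarrow>p\<rightarrow> (\<chi> i j. l i j)"
    by (intro tendsto_vec_lambda l)
  thus ?thesis ..
qed

end

section \<open>The generating function across the unit circle\<close>

context mg1_chain
begin

definition M :: "complex \<Rightarrow> complex^'m^'m" where "M z = mat z - Astar A z"

definition cramer_sol :: "'m \<Rightarrow> complex \<Rightarrow> complex" where
  "cramer_sol k z = cramer_num (M z) (rhs z) k / det (M z)"

text \<open>The determinant vanishes at 1, so the quotient itself has no useful value there; filling
  in removable singularities recovers \<open>X\<close> on the whole closed unit disc.\<close>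

definition Y :: "'m \<Rightarrow> complex \<Rightarrow> complex" where
  "Y k = remove_sings (cramer_sol k)"

lemma M_analytic: "(\<lambda>z. M z $ i $ j) analytic_on ball 0 theta"
proof -
  have "(\<lambda>z. (if i = j then z else 0) - Astar A z $ i $ j) analytic_on ball 0 theta"
    by (cases "i = j") (auto intro!: analytic_intros Astar_analytic)
  thus ?thesis by (simp add: M_def mat_def)
qed

lemma det_M_analytic: "(\<lambda>z. det (M z)) analytic_on ball 0 theta"
  by (intro analytic_on_det M_analytic)

lemma det_M_nonzero: "1 < cmod z \<Longrightarrow> cmod z < theta \<Longrightarrow> det (M z) \<noteq> 0"
  unfolding M_def by (rule det_mat_minus_Astar_nonzero)

text \<open>The determinant is analytic on the ball and nonzero at one point of the annulus, of
  modulus halfway between 1 and \<open>theta\<close>, so its zeros are isolated.\<close>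

lemma eventually_det_M_nonzero:
  assumes "cmod z < theta"
  shows "eventually (\<lambda>w. det (M w) \<noteq> 0) (at z)"
proof -
  define b where "b = complex_of_real ((1 + theta) / 2)"
  have b: "cmod b = (1 + theta) / 2"
    unfolding b_def norm_of_real using theta_gt1 by simp
  have "\<forall>\<^sub>F w in at z. det (M w) \<noteq> 0 \<and> w \<in> ball 0 theta"
  proof (rule non_zero_neighbour_alt[where \<beta> = b])
    show "(\<lambda>w. det (M w)) holomorphic_on ball 0 theta"
      by (rule analytic_imp_holomorphic[OF det_M_analytic])
    show "det (M b) \<noteq> 0"
      by (rule det_M_nonzero) (use b theta_gt1 in auto)
  qed (use assms b theta_gt1 in auto)
  thus ?thesis by eventually_elim simp
qed

lemma cramer_sol_eq_X:
  assumes "cmod z < 1" "det (M z) \<noteq> 0"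
  shows "cramer_sol k z = X z $ k"
  using cramer_num_eq[OF X_equation[OF assms(1)], of k] assms(2) by (simp add: cramer_sol_def M_def)

lemma cramer_sol_meromorphic:
  "cramer_sol k meromorphic_on U \<inter> ball 0 theta"
proof -
  have M: "(\<lambda>z. M z $ i $ j) meromorphic_on U \<inter> ball 0 theta" for i j
    by (rule meromorphic_on_subset[OF analytic_on_imp_meromorphic_on[OF M_analytic]]) auto
  have "(\<lambda>z. rhs z $ j) meromorphic_on U \<inter> ball 0 theta" for j
    unfolding rhs_def using F_mero
    by (auto intro!: meromorphic_intros intro: meromorphic_on_subset)
  thus ?thesis
    unfolding cramer_sol_def
    by (intro meromorphic_on_divide meromorphic_on_cramer_num meromorphic_on_det M)
qed

text \<open>A pole would already be visible from within the open disc, also at boundary points.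
  There the quotient is \<open>X\<close> off the zeros of the determinant, hence bounded by the
  total mass in phase k.\<close>

lemma Y_analytic_unit_disc:
  assumes z: "cmod z \<le> 1"
  shows "Y k analytic_on {z}"
proof -
  have "z \<in> U \<inter> ball 0 theta" using z U_disc rB_gt1 theta_gt1 by auto
  hence mero: "cramer_sol k meromorphic_on {z}"
    using cramer_sol_meromorphic meromorphic_on_subset by blast
  have "\<not> is_pole (cramer_sol k) z"
  proof
    assume "is_pole (cramer_sol k) z"
    hence "filterlim (cramer_sol k) at_infinity (at z within ball 0 1)"
      unfolding is_pole_def using filterlim_mono at_le subset_UNIV by blast
    moreover have "eventually (\<lambda>w. norm (cramer_sol k w) \<le> (\<Sum>n. lev n k)) (at z within ball 0 1)"
    proof -
      have "eventually (\<lambda>w. det (M w) \<noteq> 0) (at z within ball 0 1)"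
        using eventually_det_M_nonzero[of z] z theta_gt1 at_le[of "ball 0 1" UNIV z] 
        by (auto simp: le_filter_def)
      moreover have "eventually (\<lambda>w. w \<in> ball 0 1) (at z within ball 0 1)"
        by (simp add: eventually_at_filter)
      ultimately show ?thesis
        by eventually_elim (use cmod_X_le cramer_sol_eq_X in auto)
    qed
    moreover have "at z within ball 0 1 \<noteq> bot"
      using z by (simp add: trivial_limit_within islimpt_ball)
    ultimately show False by (rule filterlim_at_infinity_imp_not_bounded)
  qed
  moreover have "not_essential (cramer_sol k) z" using mero by (rule meromorphic_on_not_essential)
  ultimately obtain c where "cramer_sol k \<midarrow>z\<rightarrow> c" by (auto simp: not_essential_def)
  thus ?thesis
    unfolding Y_def
    by (intro remove_sings_analytic_at meromorphic_on_isolated_singularity[OF mero])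
qed

lemma X_continuous_on: "continuous_on (cball 0 1) (\<lambda>z. X z $ k)"
proof -
  have "uniform_limit (cball 0 1) (\<lambda>n (z::complex). \<Sum>i<n. of_real (lev i k) * z ^ i)
          (\<lambda>z. \<Sum>i. of_real (lev i k) * z ^ i) sequentially"
  proof (rule Weierstrass_m_test[OF _ lev_summable[of k]])
    fix n and z :: complex assume "z \<in> cball 0 1"
    thus "norm (of_real (lev n k) * z ^ n) \<le> lev n k"
      using lev_nonneg[of n k] by (simp add: norm_mult norm_power power_le_one mult_left_le)
  qed
  hence "continuous_on (cball 0 1) (\<lambda>z::complex. \<Sum>i. of_real (lev i k) * z ^ i)"
    by (rule uniform_limit_theorem[rotated]) (auto intro!: always_eventually continuous_intros)
  thus ?thesis by (simp add: X_def)
qed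

text \<open>The two sides agree near z within the open disc off the zeros of the determinant, and
  both are continuous from within it, so the values at z agree. The case z = 1 is the one needed for
  the tails.\<close>

lemma Y_eq_X:
  assumes z: "cmod z \<le> 1"
  shows "Y k z = X z $ k"
proof -
  have "isCont (Y k) z"
    using Y_analytic_unit_disc[OF z] by (rule analytic_at_imp_isCont)
  hence 1: "(Y k \<longlongrightarrow> Y k z) (at z within ball 0 1)"
    using at_le subset_UNIV tendsto_mono isCont_def by metis
  have "((\<lambda>w. X w $ k) \<longlongrightarrow> X z $ k) (at z within cball 0 1)"
    using X_continuous_on z by (simp add: continuous_on_def)
  hence 2: "((\<lambda>w. X w $ k) \<longlongrightarrow> X z $ k) (at z within ball 0 1)"
    by (rule tendsto_within_subset) auto
  have "z \<in> U \<inter> ball 0 theta" using z U_disc rB_gt1 theta_gt1 by auto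
  hence "cramer_sol k meromorphic_on {z}"
    using cramer_sol_meromorphic meromorphic_on_subset by blast
  hence "eventually (\<lambda>w. Y k w = cramer_sol k w) (at z)"
    unfolding Y_def by (intro eventually_remove_sings_eq_at meromorphic_on_isolated_singularity)
  moreover have "eventually (\<lambda>w. det (M w) \<noteq> 0) (at z)"
    using z theta_gt1 by (intro eventually_det_M_nonzero) auto
  ultimately have "eventually (\<lambda>w. w \<in> ball 0 1 \<longrightarrow> Y k w = X w $ k) (at z)"
    by eventually_elim (auto simp: cramer_sol_eq_X)
  hence "eventually (\<lambda>w. Y k w = X w $ k) (at z within ball 0 1)"
    by (auto simp: eventually_at_filter elim: eventually_mono)
  from Lim_transform_eventually[OF 1 this] have "((\<lambda>w. X w $ k) \<longlongrightarrow> Y k z) (at z within ball 0 1)" .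
  moreover have "at z within ball 0 1 \<noteq> bot"
    using z by (simp add: trivial_limit_within islimpt_ball)
  ultimately show ?thesis using 2 tendsto_unique by blast
qed

lemma Y_has_fps_expansion: "Y k has_fps_expansion Abs_fps (\<lambda>n. of_real (lev n k))"
proof (rule has_fps_expansionI)
  have "eventually (\<lambda>u. u \<in> ball (0::complex) 1) (nhds 0)"
    by (intro eventually_nhds_in_open) auto
  thus "eventually (\<lambda>u. (\<lambda>n. fps_nth (Abs_fps (\<lambda>n. complex_of_real (lev n k))) n * u ^ n) sums Y k u) (nhds 0)"
    by eventually_elim (simp add: X_sums Y_eq_X)
qed

lemma Y_analytic:
  assumes F: "\<And>i j. (\<lambda>z. F z $ i $ j) analytic_on {z}" and z: "cmod z < theta"
  shows "Y k analytic_on {z}"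
proof (cases "cmod z \<le> 1")
  case False
  have M: "(\<lambda>z. M z $ i $ j) analytic_on {z}" for i j
    by (rule analytic_on_subset[OF M_analytic]) (use z in auto)
  have "(\<lambda>z. rhs z $ j) analytic_on {z}" for j
    unfolding rhs_def by (auto intro!: analytic_intros F)
  hence "cramer_sol k analytic_on {z}"
    unfolding cramer_sol_def
    by (intro analytic_on_divide analytic_on_cramer_num analytic_on_det M)
       (use False z det_M_nonzero in auto)
  thus ?thesis unfolding Y_def by (rule remove_sings_analytic_on)
qed (rule Y_analytic_unit_disc)

section \<open>The generating function of the tails\<close>

definition tail :: "nat \<Rightarrow> 'm \<Rightarrow> real" where
  "tail n j = (\<Sum>i. lev (n + 1 + i) j)"

lemma tail_nonneg: "tail n j \<ge> 0"
  unfolding tail_def using summable_ignore_initial_segment[OF lev_summable, of "n + 1"]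
  by (intro suminf_nonneg lev_nonneg) (simp add: add_ac)

lemma tail_0: "of_real (tail 0 j) = X 1 $ j"
proof -
  have "(\<lambda>k. complex_of_real (lev k j)) sums of_real (\<Sum>k. lev k j)"
    by (intro sums_of_real summable_sums lev_summable)
  moreover have "(\<Sum>k. lev k j) = tail 0 j"
    using suminf_split_head[OF lev_summable, of j] by (simp add: tail_def lev_def)
  ultimately show ?thesis using X_sums[of 1 j] sums_unique2 by fastforce
qed

lemma tail_Suc: "tail n j = lev (Suc n) j + tail (Suc n) j"
proof -
  have "summable (\<lambda>i. lev (n + 1 + i) j)"
    using summable_ignore_initial_segment[OF lev_summable, of "n + 1"] by (simp add: add_ac)
  from suminf_split_head[OF this] show ?thesis by (simp add: tail_def)
qed

text \<open>Summation by parts gives the tails this generating function; 1 is a removable point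
  because \<open>Y k 1 = X 1 $ k\<close>.\<close>

definition G :: "'m \<Rightarrow> complex \<Rightarrow> complex" where
  "G k = remove_sings (\<lambda>z. (Y k z - X 1 $ k) / (z - 1))"

lemma G_analytic:
  assumes "Y k analytic_on {z}"
  shows "G k analytic_on {z}"
proof (cases "z = 1")
  case False
  hence "(\<lambda>z. (Y k z - X 1 $ k) / (z - 1)) analytic_on {z}"
    by (intro analytic_intros assms) auto
  thus ?thesis unfolding G_def by (rule remove_sings_analytic_on)
next
  case True
  have "(\<lambda>z. Y k z - X 1 $ k) analytic_on {1}"
    using assms True by (intro analytic_intros) auto
  hence iso: "isolated_singularity_at (\<lambda>z. Y k z - X 1 $ k) 1"
    and "isCont (\<lambda>z. Y k z - X 1 $ k) 1"
    by (auto intro: isolated_singularity_at_analytic analytic_at_imp_isCont)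
  hence "(\<lambda>z. Y k z - X 1 $ k) \<midarrow>1\<rightarrow> 0"
    by (simp add: isCont_def Y_eq_X)
  then obtain D where "(\<lambda>z. (Y k z - X 1 $ k) / (z - 1)) \<midarrow>1\<rightarrow> D"
    using tendsto_0_imp_tendsto_difference_quotient[OF iso] by blast
  moreover have "isolated_singularity_at (\<lambda>z. (Y k z - X 1 $ k) / (z - 1)) 1"
    using assms True
    by (intro meromorphic_on_isolated_singularity meromorphic_intros analytic_on_imp_meromorphic_on) auto
  ultimately show ?thesis
    unfolding G_def True by (intro remove_sings_analytic_at)
qed

lemma G_has_fps_expansion: "G k has_fps_expansion Abs_fps (\<lambda>n. of_real (tail n k))"
proof -
  define H where "H = Abs_fps (\<lambda>n. complex_of_real (tail n k))"
  define V where "V = Abs_fps (\<lambda>n. complex_of_real (lev n k))"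
  \<comment> \<open>Coefficients of the left side are differences of consecutive tails, that is,
    negated level probabilities; index 0 gives the total mass.\<close>
  have "(1 - fps_X) * H = fps_const (X 1 $ k) - V"
  proof (rule fps_ext)
    fix n
    show "fps_nth ((1 - fps_X) * H) n = fps_nth (fps_const (X 1 $ k) - V) n"
    proof (cases n)
      case 0
      thus ?thesis by (simp add: H_def V_def tail_0 lev_def left_diff_distrib)
    next
      case (Suc m)
      thus ?thesis using tail_Suc[of m k] by (simp add: H_def V_def left_diff_distrib fps_X_mult_nth)
    qed
  qed
  hence "inverse (1 - fps_X) * (1 - fps_X) * H = inverse (1 - fps_X) * (fps_const (X 1 $ k) - V)"
    by (simp add: mult.assoc)
  moreover have "inverse (1 - fps_X) * (1 - fps_X) = (1 :: complex fps)"
    by (rule inverse_mult_eq_1) simp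
  ultimately have H: "H = inverse (1 - fps_X) * (fps_const (X 1 $ k) - V)"
    by simp
  have expn: "(\<lambda>z. inverse (1 - z) * (X 1 $ k - Y k z)) has_fps_expansion H"
    unfolding H V_def by (intro fps_expansion_intros Y_has_fps_expansion) auto
  have ev: "eventually (\<lambda>z. inverse (1 - z) * (X 1 $ k - Y k z) = G k z) (nhds 0)"
  proof -
    have "Y k analytic_on {0}" by (rule Y_analytic_unit_disc) simp
    hence "(\<lambda>z. (Y k z - X 1 $ k) / (z - 1)) analytic_on {0}"
      by (intro analytic_intros) auto
    hence "eventually (\<lambda>z. G k z = (Y k z - X 1 $ k) / (z - 1)) (nhds 0)"
      unfolding G_def by (rule eventually_remove_sings_eq_nhds)
    thus ?thesis
    proof eventually_elim
      case (elim z)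
      have "inverse (1 - z) * (X 1 $ k - Y k z) = (X 1 $ k - Y k z) / (1 - z)"
        by (simp add: divide_inverse mult.commute)
      also have "\<dots> = (Y k z - X 1 $ k) / (z - 1)"
        using minus_divide_divide[of "Y k z - X 1 $ k" "z - 1"] by simp
      finally show ?case using elim by simp
    qed
  qed
  show ?thesis
    using expn unfolding H_def by (rule iffD1[OF has_fps_expansion_cong[OF ev refl]])
qed

text \<open>If \<open>L\<close> is the leading coefficient of \<open>F\<close> at \<open>p\<close>,
  this is that of the continued generating function; division by \<open>p - 1\<close> gives that of
  the tails.\<close>

definition ell :: "complex^'m^'p \<Rightarrow> complex \<Rightarrow> complex^'m" where
  "ell L p = (((\<chi> j. complex_of_real (x (L0 j))) v* L) v* matrix_inv (mat 1 - GammaA A p))"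

lemma M_eq_Gamma: "p \<noteq> 0 \<Longrightarrow> M p $ i $ j = p * (mat 1 - GammaA A p) $ i $ j"
  by (simp add: M_def mat_def GammaA_def right_diff_distrib)

text \<open>\<open>M p\<close> is p times \<open>mat 1 - GammaA A p\<close>, so the nonzero
  determinant on the annulus makes \<open>matrix_inv\<close> a genuine inverse.\<close>

lemma ell_solves:
  assumes p: "1 < cmod p" "cmod p < theta"
  shows "ell L p v* (mat 1 - GammaA A p) = (\<chi> j. complex_of_real (x (L0 j))) v* L"
    and "ell L p v* M p = p *s ((\<chi> j. complex_of_real (x (L0 j))) v* L)"
proof -
  have p0: "p \<noteq> 0" using p by auto
  have "invertible (M p)" using det_M_nonzero[OF p] by (simp add: invertible_det_nz)
  then obtain N where N: "N ** M p = mat 1" by (auto simp: invertible_left_inverse)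
  have "(\<chi> i j. p * N $ i $ j) ** (mat 1 - GammaA A p) = N ** M p"
    using p0 by (simp add: vec_eq_iff matrix_matrix_mult_def M_eq_Gamma[OF p0] mult_ac)
  hence "invertible (mat 1 - GammaA A p)"
    using N by (auto simp: invertible_left_inverse)
  hence "matrix_inv (mat 1 - GammaA A p) ** (mat 1 - GammaA A p) = mat 1"
    unfolding invertible_def matrix_inv_def by (rule someI2_ex) simp
  thus 1: "ell L p v* (mat 1 - GammaA A p) = (\<chi> j. complex_of_real (x (L0 j))) v* L"
    by (simp add: ell_def vector_matrix_mul_assoc matrix_mul_assoc[symmetric])
  have "ell L p v* M p = p *s (ell L p v* (mat 1 - GammaA A p))"
    by (simp add: vec_eq_iff vector_matrix_mult_def M_eq_Gamma[OF p0] sum_distrib_left mult_ac)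
  thus "ell L p v* M p = p *s ((\<chi> j. complex_of_real (x (L0 j))) v* L)"
    by (simp add: 1)
qed

text \<open>The factor \<open>(1 - z / p) ^ mB\<close> moves into the right-hand side of Cramer's
  rule, where its limit is known, and the determinant has a nonzero limit.\<close>

lemma Y_limit:
  assumes p: "cmod p = rB" and L: "(\<lambda>z. \<chi> i j. (1 - z / p) ^ mB * F z $ i $ j) \<midarrow>p\<rightarrow> L"
  shows "(\<lambda>z. (1 - z / p) ^ mB * Y k z) \<midarrow>p\<rightarrow> ell L p $ k"
proof -
  have p': "1 < cmod p" "cmod p < theta" "p \<noteq> 0" using p rB_gt1 theta_gt_rB by auto
  have M: "(\<lambda>z. M z $ i $ j) \<midarrow>p\<rightarrow> M p $ i $ j" for i j
  proof -
    have "(\<lambda>z. M z $ i $ j) analytic_on {p}"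
      by (rule analytic_on_subset[OF M_analytic]) (use p' in auto)
    thus ?thesis using analytic_at_imp_isCont isCont_def by blast
  qed
  have Lij: "(\<lambda>z. (1 - z / p) ^ mB * F z $ i $ j) \<midarrow>p\<rightarrow> L $ i $ j" for i j
    using tendsto_vec_nth[OF tendsto_vec_nth[OF L, of i], of j] by simp
  \<comment> \<open>Since \<open>mB\<close> is positive, the bounded term with \<open>A 0\<close>
    disappears in the limit.\<close>
  have small: "(\<lambda>z. (1 - z / p) ^ mB) \<midarrow>p\<rightarrow> 0"
  proof -
    have "(\<lambda>z. (1 - z / p) ^ mB) \<midarrow>p\<rightarrow> (1 - p / p) ^ mB"
      by (intro tendsto_intros) (use p' in auto)
    thus ?thesis using p' mB_pos by (simp add: power_0_left)
  qed
  define b where "b = p *s ((\<chi> j. complex_of_real (x (L0 j))) v* L)"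
  have rhs: "(\<lambda>z. ((1 - z / p) ^ mB *s rhs z) $ j) \<midarrow>p\<rightarrow> b $ j" for j
  proof -
    have "(\<lambda>z. z * ((\<Sum>i\<in>UNIV. of_real (x (L0 i)) * ((1 - z / p) ^ mB * F z $ i $ j))
             - (1 - z / p) ^ mB * (\<Sum>i\<in>UNIV. of_real (lev 1 i * A 0 $ i $ j))))
       \<midarrow>p\<rightarrow> p * ((\<Sum>i\<in>UNIV. of_real (x (L0 i)) * L $ i $ j)
             - 0 * (\<Sum>i\<in>UNIV. of_real (lev 1 i * A 0 $ i $ j)))"
      by (intro tendsto_intros Lij small)
    thus ?thesis
      by (simp add: rhs_def b_def vector_matrix_mult_def right_diff_distrib sum_distrib_left mult_ac)
  qed
  have "(\<lambda>z. cramer_num (M z) ((1 - z / p) ^ mB *s rhs z) k / det (M z))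
          \<midarrow>p\<rightarrow> cramer_num (M p) b k / det (M p)"
    by (intro tendsto_divide tendsto_cramer_num tendsto_det M rhs det_M_nonzero p')
  also have "cramer_num (M p) b k / det (M p) = ell L p $ k"
    using cramer_num_eq[OF ell_solves(2)[OF p'(1,2), of L], of k] det_M_nonzero[OF p'(1,2)]
    by (simp add: b_def)
  finally have lim: "(\<lambda>z. (1 - z / p) ^ mB * cramer_sol k z) \<midarrow>p\<rightarrow> ell L p $ k"
    by (simp add: cramer_num_scale cramer_sol_def)
  have "p \<in> U \<inter> ball 0 theta" using p p' U_disc by auto
  hence "cramer_sol k meromorphic_on {p}"
    using cramer_sol_meromorphic meromorphic_on_subset by blast
  hence "eventually (\<lambda>w. Y k w = cramer_sol k w) (at p)"
    unfolding Y_def by (intro eventually_remove_sings_eq_at meromorphic_on_isolated_singularity)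
  hence "eventually (\<lambda>w. (1 - w / p) ^ mB * cramer_sol k w = (1 - w / p) ^ mB * Y k w) (at p)"
    by eventually_elim simp
  from Lim_transform_eventually[OF lim this] show ?thesis .
qed

text \<open>The constant \<open>X 1\<close> is killed by the vanishing factor. The assumption
  \<open>ana\<close> makes \<open>G\<close> the plain quotient near \<open>p\<close>.\<close>

lemma G_limit:
  assumes p: "cmod p = rB" and L: "(\<lambda>z. \<chi> i j. (1 - z / p) ^ mB * F z $ i $ j) \<midarrow>p\<rightarrow> L"
    and ana: "eventually (\<lambda>z. Y k analytic_on {z}) (at p)"
  shows "(\<lambda>z. (1 - z / p) ^ mB * G k z) \<midarrow>p\<rightarrow> ell L p $ k / (p - 1)"
proof -
  have p': "p \<noteq> 0" "p \<noteq> 1" using p rB_gt1 by auto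
  have "(\<lambda>z. ((1 - z / p) ^ mB * Y k z - (1 - z / p) ^ mB * X 1 $ k) / (z - 1))
          \<midarrow>p\<rightarrow> (ell L p $ k - (1 - p / p) ^ mB * X 1 $ k) / (p - 1)"
    by (intro tendsto_intros Y_limit p L) (use p' in auto)
  hence lim: "(\<lambda>z. ((1 - z / p) ^ mB * Y k z - (1 - z / p) ^ mB * X 1 $ k) / (z - 1))
          \<midarrow>p\<rightarrow> ell L p $ k / (p - 1)"
    using p' mB_pos by (simp add: power_0_left)
  have "eventually (\<lambda>z. z \<in> - {1}) (at p)"
    using p' by (intro eventually_at_in_open') auto
  with ana have "eventually (\<lambda>z. ((1 - z / p) ^ mB * Y k z - (1 - z / p) ^ mB * X 1 $ k) / (z - 1) =
      (1 - z / p) ^ mB * G k z) (at p)"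
  proof eventually_elim
    case (elim z)
    have "(\<lambda>z. (Y k z - X 1 $ k) / (z - 1)) analytic_on {z}"
      using elim by (intro analytic_intros) auto
    hence "G k z = (Y k z - X 1 $ k) / (z - 1)"
      unfolding G_def by (rule remove_sings_at_analytic)
    thus ?case by (simp add: right_diff_distrib)
  qed
  from Lim_transform_eventually[OF lim this] show ?thesis .
qed

end

subsection \<open>Almost periodic sequences\<close>

text \<open>Simultaneous Dirichlet approximation is applied to the angles, in turns, multiplied by
  \<open>Q'\<close>. The return time is then a positive multiple of \<open>Q'\<close>, hence as late
  as desired.\<close>

lemma simultaneous_return:
  fixes Z :: "complex set"
  assumes "finite Z" "\<And>\<zeta>. \<zeta> \<in> Z \<Longrightarrow> cmod \<zeta> = 1" "\<epsilon> > 0"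
  obtains n where "n \<ge> Q" "\<And>\<zeta>. \<zeta> \<in> Z \<Longrightarrow> cmod (\<zeta> ^ n - 1) < \<epsilon>"
proof -
  obtain h where h: "bij_betw h {0..<card Z} Z"
    using ex_bij_betw_nat_finite[OF assms(1)] by blast
  \<comment> \<open>An error of \<open>1 / N\<close> turns is an angle below \<epsilon>.\<close>
  define N where "N = nat \<lceil>2 * pi / \<epsilon>\<rceil> + 1"
  have N: "N > 0" by (simp add: N_def)
  have "2 * pi / \<epsilon> < real N" unfolding N_def by linarith
  hence N\<epsilon>: "2 * pi / real N < \<epsilon>" using assms(3) N by (simp add: field_simps)
  define Q' where "Q' = max Q 1"
  obtain q p where q: "0 < q"
    "\<And>i. i < card Z \<Longrightarrow> \<bar>of_int q * (real Q' * Arg (h i) / (2 * pi)) - of_int (p i)\<bar> < 1 / N"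
    using Dirichlet_approx_simult[OF N, of "card Z" "\<lambda>i. real Q' * Arg (h i) / (2 * pi)"] by metis
  show ?thesis
  proof (rule that[of "Q' * nat q"])
    have "Q' * 1 \<le> Q' * nat q" using q(1) by (intro mult_left_mono) auto
    thus "Q \<le> Q' * nat q" by (simp add: Q'_def)
    fix \<zeta> assume \<zeta>: "\<zeta> \<in> Z"
    then obtain i where i: "i < card Z" "h i = \<zeta>"
      using h by (auto simp: bij_betw_def image_iff) (metis atLeast0LessThan imageE lessThan_iff)
    define y where "y = 2 * pi * (of_int q * (real Q' * Arg \<zeta> / (2 * pi)) - of_int (p i))"
    have "\<zeta> = cis (Arg \<zeta>)"
      using rcis_cmod_Arg[of \<zeta>] assms(2)[OF \<zeta>] by (simp add: rcis_def)
    hence "\<zeta> ^ (Q' * nat q) = cis (Arg \<zeta>) ^ (Q' * nat q)" by simp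
    also have "\<dots> = cis (real (Q' * nat q) * Arg \<zeta>)" by (rule Complex.DeMoivre)
    also have "real (Q' * nat q) * Arg \<zeta> = y + 2 * pi * of_int (p i)"
      using q(1) by (simp add: y_def field_simps)
    also have "cis (y + 2 * pi * of_int (p i)) = cis y"
      by (simp flip: cis_mult add: cis_multiple_2pi)
    finally have "cmod (\<zeta> ^ (Q' * nat q) - 1) = 2 * \<bar>sin (y / 2)\<bar>"
      by (simp add: cis_conv_exp dist_exp_i_1)
    also have "\<dots> \<le> \<bar>y\<bar>" using abs_sin_x_le_abs_x[of "y / 2"] by simp
    also have "\<dots> = 2 * pi * \<bar>of_int q * (real Q' * Arg \<zeta> / (2 * pi)) - of_int (p i)\<bar>"
      by (simp add: y_def abs_mult)
    also have "\<dots> \<le> 2 * pi * (1 / N)"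
      using q(2)[OF i(1)] i(2) by (intro mult_left_mono) auto
    also have "\<dots> < \<epsilon>" using N\<epsilon> by simp
    finally show "cmod (\<zeta> ^ (Q' * nat q) - 1) < \<epsilon>" .
  qed
qed

lemma almost_periodic_return:
  fixes c :: "complex \<Rightarrow> complex"
  assumes Z: "finite Z" "\<And>\<zeta>. \<zeta> \<in> Z \<Longrightarrow> cmod \<zeta> = 1" and "\<epsilon> > 0"
  obtains n where "n \<ge> Q" "cmod ((\<Sum>\<zeta>\<in>Z. c \<zeta> / \<zeta> ^ (k + n)) - (\<Sum>\<zeta>\<in>Z. c \<zeta> / \<zeta> ^ k)) < \<epsilon>"
proof -
  \<comment> \<open>The summand 1 keeps \<open>K\<close> positive and the final inequality
    strict.\<close>
  define K where "K = 1 + (\<Sum>\<zeta>\<in>Z. cmod (c \<zeta>))"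
  have K: "K > 0" unfolding K_def by (simp add: add_pos_nonneg sum_nonneg)
  obtain n where n: "n \<ge> Q" "\<And>\<zeta>. \<zeta> \<in> Z \<Longrightarrow> cmod (\<zeta> ^ n - 1) < \<epsilon> / K"
    using simultaneous_return[OF Z, of "\<epsilon> / K" Q] assms(3) K by auto
  have "cmod ((\<Sum>\<zeta>\<in>Z. c \<zeta> / \<zeta> ^ (k + n)) - (\<Sum>\<zeta>\<in>Z. c \<zeta> / \<zeta> ^ k)) \<le>
          (\<Sum>\<zeta>\<in>Z. cmod (c \<zeta> / \<zeta> ^ (k + n) - c \<zeta> / \<zeta> ^ k))"
    unfolding sum_subtractf[symmetric] by (rule norm_sum)
  also have "\<dots> \<le> (\<Sum>\<zeta>\<in>Z. cmod (c \<zeta>) * (\<epsilon> / K))"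
  proof (rule sum_mono)
    fix \<zeta> assume \<zeta>: "\<zeta> \<in> Z"
    hence "\<zeta> \<noteq> 0" using Z(2) by force
    hence "c \<zeta> / \<zeta> ^ (k + n) - c \<zeta> / \<zeta> ^ k = c \<zeta> * (1 - \<zeta> ^ n) / \<zeta> ^ (k + n)"
      by (simp add: power_add field_simps)
    hence "cmod (c \<zeta> / \<zeta> ^ (k + n) - c \<zeta> / \<zeta> ^ k) = cmod (c \<zeta>) * cmod (\<zeta> ^ n - 1)"
      using Z(2)[OF \<zeta>] by (simp add: norm_mult norm_divide norm_power norm_minus_commute)
    also have "\<dots> \<le> cmod (c \<zeta>) * (\<epsilon> / K)"
      using n(2)[OF \<zeta>] by (intro mult_left_mono) auto
    finally show "cmod (c \<zeta> / \<zeta> ^ (k + n) - c \<zeta> / \<zeta> ^ k) \<le> cmod (c \<zeta>) * (\<epsilon> / K)" .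
  qed
  also have "\<dots> = (K - 1) * (\<epsilon> / K)" unfolding sum_distrib_right[symmetric] by (simp add: K_def)
  also have "\<dots> < \<epsilon>" using K assms(3) by (simp add: field_simps)
  finally show ?thesis using n(1) that by blast
qed

text \<open>A late return n makes the sum at k + n close to its value at k and also to
  \<open>a (k + n)\<close>. The information about large indices thus reaches every k.\<close>

lemma almost_periodic_nonneg:
  fixes c :: "complex \<Rightarrow> complex" and a :: "nat \<Rightarrow> real"
  assumes Z: "finite Z" "\<And>\<zeta>. \<zeta> \<in> Z \<Longrightarrow> cmod \<zeta> = 1" and a: "\<And>k. a k \<ge> 0"
    and lim: "(\<lambda>k. of_real (a k) - (\<Sum>\<zeta>\<in>Z. c \<zeta> / \<zeta> ^ k)) \<longlonglongrightarrow> 0"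
  shows "Im (\<Sum>\<zeta>\<in>Z. c \<zeta> / \<zeta> ^ k) = 0 \<and> Re (\<Sum>\<zeta>\<in>Z. c \<zeta> / \<zeta> ^ k) \<ge> 0"
proof -
  define s where "s = (\<lambda>k. \<Sum>\<zeta>\<in>Z. c \<zeta> / \<zeta> ^ k)"
  have *: "\<bar>Im (s k)\<bar> \<le> e \<and> - e \<le> Re (s k)" if "e > 0" for e
  proof -
    obtain Q where Q: "\<And>n. n \<ge> Q \<Longrightarrow> cmod (of_real (a n) - s n) < e / 2"
      using LIMSEQ_D[OF lim, of "e / 2"] \<open>e > 0\<close> by (auto simp: s_def)
    obtain n where n: "n \<ge> Q" "cmod (s (k + n) - s k) < e / 2"
      using almost_periodic_return[OF Z, of "e / 2" Q c k] \<open>e > 0\<close> unfolding s_def by auto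
    have "of_real (a (k + n)) - s k = (of_real (a (k + n)) - s (k + n)) + (s (k + n) - s k)"
      by simp
    hence "cmod (of_real (a (k + n)) - s k) \<le> cmod (of_real (a (k + n)) - s (k + n)) + cmod (s (k + n) - s k)"
      by (metis norm_triangle_ineq)
    hence "cmod (of_real (a (k + n)) - s k) < e"
      using Q[of "k + n"] n by simp
    hence "\<bar>Im (of_real (a (k + n)) - s k)\<bar> < e" "\<bar>Re (of_real (a (k + n)) - s k)\<bar> < e"
      using abs_Im_le_cmod abs_Re_le_cmod le_less_trans by blast+
    thus ?thesis using a[of "k + n"] by auto
  qed
  have "\<bar>Im (s k)\<bar> \<le> 0" by (rule field_le_epsilon) (use * in auto)
  moreover have "- Re (s k) \<le> 0"
  proof (rule field_le_epsilon)
    fix e :: real assume "0 < e"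
    thus "- Re (s k) \<le> 0 + e" using *[of e] by linarith
  qed
  ultimately show ?thesis by (simp add: s_def)
qed

text \<open>One positive value suffices: the sequence comes back to within half of it arbitrarily
  late.\<close>

lemma almost_periodic_Limsup_pos:
  fixes c :: "complex \<Rightarrow> complex"
  assumes Z: "finite Z" "\<And>\<zeta>. \<zeta> \<in> Z \<Longrightarrow> cmod \<zeta> = 1" and one: "1 \<in> Z" "c 1 \<noteq> 0"
    and nonneg: "\<And>k. Im (\<Sum>\<zeta>\<in>Z. c \<zeta> / \<zeta> ^ k) = 0 \<and> Re (\<Sum>\<zeta>\<in>Z. c \<zeta> / \<zeta> ^ k) \<ge> 0"
  shows "Limsup sequentially (\<lambda>k. ereal (Re (\<Sum>\<zeta>\<in>Z. c \<zeta> / \<zeta> ^ k))) > 0"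
proof -
  define s where "s = (\<lambda>k. \<Sum>\<zeta>\<in>Z. c \<zeta> / \<zeta> ^ k)"
  text \<open>The partial sums of \<open>s\<close> are \<open>n c(1) + O(1)\<close>, hence \<open>s\<close> does not vanish identically.\<close>
  have "\<exists>k. Re (s k) > 0"
  proof (rule ccontr)
    assume "\<not> ?thesis"
    hence s0: "s k = 0" for k
      using nonneg[of k] by (auto simp: s_def complex_eq_iff not_less intro: antisym)
    \<comment> \<open>For \<zeta> other than 1 these constants bound the geometric sums uniformly in
      n.\<close>
    define K where "K = (\<Sum>\<zeta>\<in>Z - {1}. cmod (c \<zeta>) * (2 / cmod (1 - 1 / \<zeta>)))"
    have bound: "real n * cmod (c 1) \<le> K" for n
    proof -
      have "0 = (\<Sum>k<n. s k)" by (simp add: s0)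
      also have "\<dots> = (\<Sum>\<zeta>\<in>Z. \<Sum>k<n. c \<zeta> / \<zeta> ^ k)"
        unfolding s_def by (rule sum.swap)
      also have "\<dots> = of_nat n * c 1 + (\<Sum>\<zeta>\<in>Z - {1}. \<Sum>k<n. c \<zeta> / \<zeta> ^ k)"
        using Z(1) one(1) by (simp add: sum.remove[of Z 1])
      finally have "of_nat n * c 1 = - (\<Sum>\<zeta>\<in>Z - {1}. \<Sum>k<n. c \<zeta> / \<zeta> ^ k)"
        by (simp add: eq_neg_iff_add_eq_0)
      hence "real n * cmod (c 1) = cmod (\<Sum>\<zeta>\<in>Z - {1}. \<Sum>k<n. c \<zeta> / \<zeta> ^ k)"
        by (metis norm_minus_cancel norm_mult norm_of_nat)
      also have "\<dots> \<le> K"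
        unfolding K_def
      proof (rule sum_norm_le)
        fix \<zeta> assume \<zeta>: "\<zeta> \<in> Z - {1}"
        have \<zeta>1: "1 / \<zeta> \<noteq> 1" using \<zeta> by auto
        have "(\<Sum>k<n. c \<zeta> / \<zeta> ^ k) = c \<zeta> * (\<Sum>k<n. (1 / \<zeta>) ^ k)"
          by (simp add: sum_distrib_left power_one_over)
        also have "(\<Sum>k<n. (1 / \<zeta>) ^ k) = (1 - (1 / \<zeta>) ^ n) / (1 - 1 / \<zeta>)"
          by (simp only: sum_gp_strict \<zeta>1 if_False)
        finally have "norm (\<Sum>k<n. c \<zeta> / \<zeta> ^ k) = cmod (c \<zeta>) * (cmod (1 - (1 / \<zeta>) ^ n) / cmod (1 - 1 / \<zeta>))"
          by (simp only: norm_mult norm_divide)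
        also have "\<dots> \<le> cmod (c \<zeta>) * (2 / cmod (1 - 1 / \<zeta>))"
        proof (intro mult_left_mono divide_right_mono)
          have "cmod (1 - (1 / \<zeta>) ^ n) \<le> 1 + cmod ((1 / \<zeta>) ^ n)"
            using norm_triangle_ineq4[of 1 "(1 / \<zeta>) ^ n"] by simp
          also have "cmod ((1 / \<zeta>) ^ n) = 1" using Z(2)[of \<zeta>] \<zeta> by (simp add: norm_power norm_divide)
          finally show "cmod (1 - (1 / \<zeta>) ^ n) \<le> 2" by simp
        qed auto
        finally show "norm (\<Sum>k<n. c \<zeta> / \<zeta> ^ k) \<le> cmod (c \<zeta>) * (2 / cmod (1 - 1 / \<zeta>))" .
      qed
      finally show ?thesis .
    qed
    obtain n where "K < real n * cmod (c 1)"
      using reals_Archimedean3[of "cmod (c 1)"] one(2) by auto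
    with bound[of n] show False by simp
  qed
  then obtain k0 where k0: "Re (s k0) > 0" ..
  show ?thesis
  proof (rule ccontr)
    assume "\<not> ?thesis"
    hence "Limsup sequentially (\<lambda>k. ereal (Re (s k))) \<le> 0"
      by (simp add: s_def not_less)
    also have "0 < ereal (Re (s k0) / 2)" using k0 by simp
    finally have "eventually (\<lambda>k. ereal (Re (s k)) < ereal (Re (s k0) / 2)) sequentially"
      by (rule Limsup_lessD)
    then obtain Q where Q: "\<And>k. k \<ge> Q \<Longrightarrow> Re (s k) < Re (s k0) / 2"
      by (auto simp: eventually_sequentially)
    obtain n where n: "n \<ge> Q" "cmod (s (k0 + n) - s k0) < Re (s k0) / 2"
      using almost_periodic_return[OF Z, of "Re (s k0) / 2" Q c k0] k0 unfolding s_def by auto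
    have "\<bar>Re (s (k0 + n)) - Re (s k0)\<bar> < Re (s k0) / 2"
      using n(2) abs_Re_le_cmod[of "s (k0 + n) - s k0"] by simp
    moreover have "Re (s (k0 + n)) < Re (s k0) / 2" using n(1) by (intro Q) simp
    ultimately show False by linarith
  qed
qed

subsection \<open>Asymptotics of the tails\<close>

text \<open>Dividing by the leading weight turns the error bound into the limit required by the
  recurrence argument: the quotient is of order \<open>(r / (r + \<epsilon>)) ^ k\<close> for
  \<open>m = 1\<close> and 1 / k otherwise.\<close>

lemma scaled_error_tendsto_0:
  fixes s :: "nat \<Rightarrow> complex" and a :: "nat \<Rightarrow> real" and r \<epsilon> :: real and m :: nat
  defines "E \<equiv> (\<lambda>k. cmod (of_real (a k) - of_real (real k ^ (m - 1) / fact (m - 1) / r ^ k) * s k))"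
  assumes r: "r > 0" and m: "m \<ge> 1" and \<epsilon>: "\<epsilon> > 0"
    and E1: "m = 1 \<Longrightarrow> E \<in> O(\<lambda>k. 1 / (r + \<epsilon>) ^ k)"
    and E2: "m \<ge> 2 \<Longrightarrow> E \<in> O(\<lambda>k. real k ^ (m - 2) / r ^ k)"
  shows "(\<lambda>k. of_real (a k * r ^ k * fact (m - 1) / real k ^ (m - 1)) - s k) \<longlonglongrightarrow> 0"
proof -
  \<comment> \<open>At k = 0 the weight may vanish.\<close>
  have eq: "cmod (of_real (a k * r ^ k * fact (m - 1) / real k ^ (m - 1)) - s k) =
            E k * (r ^ k * fact (m - 1) / real k ^ (m - 1))" if "k \<ge> 1" for k
  proof -
    define w where "w = real k ^ (m - 1) / fact (m - 1) / r ^ k"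
    have w: "w > 0" using that r by (simp add: w_def)
    have inv: "r ^ k * fact (m - 1) / real k ^ (m - 1) = 1 / w" by (simp add: w_def)
    have "a k * r ^ k * fact (m - 1) / real k ^ (m - 1) = a k * (1 / w)" by (simp add: w_def)
    moreover have "of_real (a k * (1 / w)) - s k = (of_real (a k) - of_real w * s k) * of_real (1 / w)"
      using w by (simp add: field_simps)
    ultimately have "of_real (a k * r ^ k * fact (m - 1) / real k ^ (m - 1)) - s k =
          (of_real (a k) - of_real w * s k) * of_real (1 / w)"
      by (simp only:)
    hence "cmod (of_real (a k * r ^ k * fact (m - 1) / real k ^ (m - 1)) - s k) =
           cmod (of_real (a k) - of_real w * s k) * (1 / w)"
      using w by (simp only: norm_mult norm_of_real) simp
    thus ?thesis by (simp add: inv E_def w_def)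
  qed
  obtain h :: "nat \<Rightarrow> real" where h: "h \<longlonglongrightarrow> 0"
    "eventually (\<lambda>k. E k * (r ^ k * fact (m - 1) / real k ^ (m - 1)) \<le> h k) sequentially"
  proof (cases "m = 1")
    case True
    obtain C where C: "eventually (\<lambda>k. norm (E k) \<le> C * norm (1 / (r + \<epsilon>) ^ k)) sequentially"
      using E1[OF True] by (auto elim: landau_o.bigE)
    show ?thesis
    proof (rule that[of "\<lambda>k. C * (r / (r + \<epsilon>)) ^ k"])
      have "(\<lambda>k. C * (r / (r + \<epsilon>)) ^ k) \<longlonglongrightarrow> C * 0"
        using r \<epsilon> by (intro tendsto_mult tendsto_const LIMSEQ_power_zero) auto
      thus "(\<lambda>k. C * (r / (r + \<epsilon>)) ^ k) \<longlonglongrightarrow> 0" by simp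
      show "eventually (\<lambda>k. E k * (r ^ k * fact (m - 1) / real k ^ (m - 1)) \<le> C * (r / (r + \<epsilon>)) ^ k) sequentially"
        using C
      proof eventually_elim
        case (elim k)
        have "E k \<le> C / (r + \<epsilon>) ^ k" using elim r \<epsilon> by (simp add: E_def)
        hence "E k * r ^ k \<le> C / (r + \<epsilon>) ^ k * r ^ k" using r by (intro mult_right_mono) auto
        thus ?case using True by (simp add: power_divide)
      qed
    qed
  next
    case False
    then obtain n where n: "m = Suc (Suc n)" using m by (cases m; cases "m - 1") auto
    obtain C where C: "eventually (\<lambda>k. norm (E k) \<le> C * norm (real k ^ (m - 2) / r ^ k)) sequentially"
      using E2 n by (auto elim: landau_o.bigE)
    show ?thesis
    proof (rule that[of "\<lambda>k. C * fact (m - 1) * (1 / real k)"])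
      have "(\<lambda>k. C * fact (m - 1) * (1 / real k)) \<longlonglongrightarrow> C * fact (m - 1) * 0"
        by (intro tendsto_mult tendsto_const lim_1_over_n)
      thus "(\<lambda>k. C * fact (m - 1) * (1 / real k)) \<longlonglongrightarrow> 0" by simp
      show "eventually (\<lambda>k. E k * (r ^ k * fact (m - 1) / real k ^ (m - 1)) \<le> C * fact (m - 1) * (1 / real k)) sequentially"
        using C eventually_ge_at_top[of 1]
      proof eventually_elim
        case (elim k)
        have "E k \<le> C * (real k ^ n / r ^ k)" using elim r by (simp add: E_def n)
        hence "E k * (r ^ k * fact (m - 1) / real k ^ (m - 1)) \<le>
               C * (real k ^ n / r ^ k) * (r ^ k * fact (m - 1) / real k ^ (m - 1))"
          using r by (intro mult_right_mono) auto
        also have "\<dots> = C * fact (m - 1) * (1 / real k)"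
          using elim r by (simp add: n del: fact_Suc)
        finally show ?case .
      qed
    qed
  qed
  show ?thesis
  proof (rule Lim_null_comparison[OF _ h(1)])
    show "eventually (\<lambda>k. norm (complex_of_real (a k * r ^ k * fact (m - 1) / real k ^ (m - 1)) - s k) \<le> h k) sequentially"
      using h(2) eventually_ge_at_top[of 1] by eventually_elim (simp only: eq)
  qed
qed

context mg1_chain
begin

text \<open>All singularities of \<open>F\<close> on the circle go into the pole set, each with its
  limit at order \<open>mB\<close>. Outside \<open>Zs\<close> this limit is 0, so those points drop
  out of the leading sum.\<close>

lemma tail_asymp:
  fixes Bt :: "complex \<Rightarrow> complex^'m^'p" and j :: 'm
  defines "Zs \<equiv> {\<zeta>. cmod \<zeta> = 1 \<and> (\<exists>L. L \<noteq> 0 \<and>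
              ((\<lambda>z. \<chi> i j. (1 - z / (complex_of_real rB * \<zeta>)) ^ mB * F z $ i $ j)
                 \<longlongrightarrow> L) (at (complex_of_real rB * \<zeta>)))}"
  assumes fin: "finite Zs"
    and Bt: "\<And>\<zeta>. \<zeta> \<in> Zs \<Longrightarrow>
                 ((\<lambda>z. \<chi> i j. (1 - z / (complex_of_real rB * \<zeta>)) ^ mB * F z $ i $ j)
                    \<longlongrightarrow> Bt \<zeta>) (at (complex_of_real rB * \<zeta>))"
  defines "s \<equiv> (\<lambda>k. \<Sum>\<zeta>\<in>Zs. (ell (Bt \<zeta>) (of_real rB * \<zeta>) $ j / (of_real rB * \<zeta> - 1)) / \<zeta> ^ k)"
  defines "E \<equiv> (\<lambda>k. cmod (of_real (tail k j) - of_real (real k ^ (mB - 1) / fact (mB - 1) / rB ^ k) * s k))"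
  shows "\<exists>\<epsilon>>0. (mB = 1 \<longrightarrow> E \<in> O(\<lambda>k. 1 / (rB + \<epsilon>) ^ k)) \<and>
                (mB \<ge> 2 \<longrightarrow> E \<in> O(\<lambda>k. real k ^ (mB - 2) / rB ^ k))"
proof -
  obtain P0 R where PR: "finite P0" "P0 \<subseteq> sphere 0 rB" "rB < R" "R < theta"
    and F_ana: "\<forall>i j. (\<lambda>z. F z $ i $ j) analytic_on ball 0 R - P0"
    using F_poles by blast
  define P where "P = P0 \<union> (\<lambda>\<zeta>. of_real rB * \<zeta>) ` Zs"
  have P: "finite P" "P \<subseteq> sphere 0 rB"
    using PR fin rB_gt1 by (auto simp: P_def Zs_def norm_mult)
  have "\<exists>L. (\<lambda>z. \<chi> i j. (1 - z / p) ^ mB * F z $ i $ j) \<midarrow>p\<rightarrow> (L :: complex^'m^'p)" if "p \<in> P" for p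
    by (rule F_limit_exists) (use P that in auto)
  hence "\<exists>Lf. \<forall>p\<in>P. (\<lambda>z. \<chi> i j. (1 - z / p) ^ mB * F z $ i $ j) \<midarrow>p\<rightarrow> (Lf p :: complex^'m^'p)"
    by (intro bchoice ballI)
  then obtain Lf :: "complex \<Rightarrow> complex^'m^'p" where Lf:
    "\<And>p. p \<in> P \<Longrightarrow> (\<lambda>z. \<chi> i j. (1 - z / p) ^ mB * F z $ i $ j) \<midarrow>p\<rightarrow> Lf p" by blast
  have Y_ana: "Y j analytic_on {z}" if "z \<in> ball 0 R - P" for z
  proof (rule Y_analytic)
    fix i j
    show "(\<lambda>z. F z $ i $ j) analytic_on {z}"
      by (rule analytic_on_subset[OF F_ana[rule_format]]) (use that in \<open>auto simp: P_def\<close>)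
  qed (use that PR in auto)
  have G_ana: "G j analytic_on ball 0 R - P"
    by (subst analytic_on_analytic_at) (use Y_ana G_analytic in blast)
  have "(\<lambda>z. (1 - z / p) ^ mB * G j z) \<midarrow>p\<rightarrow> ell (Lf p) p $ j / (p - 1)" if p: "p \<in> P" for p
  proof (rule G_limit[OF _ Lf[OF p]])
    show "cmod p = rB" using p P by auto
    have "open (ball 0 R - (P - {p}))" using P by (intro open_Diff finite_imp_closed) auto
    hence "eventually (\<lambda>z. z \<in> ball 0 R - (P - {p}) - {p}) (at p)"
      using p P PR(3) by (intro eventually_at_in_open) auto
    thus "eventually (\<lambda>z. Y j analytic_on {z}) (at p)"
      by eventually_elim (use Y_ana in auto)
  qed
  from coeff_asymp_poles_on_circle[OF G_has_fps_expansion P _ PR(3) G_ana this mB_pos] rB_gt1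
  have "\<exists>\<epsilon>>0.
     (mB = 1 \<longrightarrow> (\<lambda>k. cmod (complex_of_real (tail k j) - complex_of_real (real k ^ (mB - 1) / fact (mB - 1)) *
               (\<Sum>p\<in>P. ell (Lf p) p $ j / (p - 1) / p ^ k))) \<in> O(\<lambda>k. 1 / (rB + \<epsilon>) ^ k)) \<and>
     (2 \<le> mB \<longrightarrow> (\<lambda>k. cmod (complex_of_real (tail k j) - complex_of_real (real k ^ (mB - 1) / fact (mB - 1)) *
               (\<Sum>p\<in>P. ell (Lf p) p $ j / (p - 1) / p ^ k))) \<in> O(\<lambda>k. real k ^ (mB - 2) / rB ^ k))"
    by auto
  moreover have "(\<Sum>p\<in>P. ell (Lf p) p $ j / (p - 1) / p ^ k) = s k / of_real rB ^ k" for k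
  proof -
    have "(\<Sum>p\<in>P. ell (Lf p) p $ j / (p - 1) / p ^ k) =
          (\<Sum>p\<in>(\<lambda>\<zeta>. of_real rB * \<zeta>) ` Zs. ell (Lf p) p $ j / (p - 1) / p ^ k)"
    proof (rule sum.mono_neutral_right[OF P(1)])
      show "\<forall>p\<in>P - (\<lambda>\<zeta>. of_real rB * \<zeta>) ` Zs. ell (Lf p) p $ j / (p - 1) / p ^ k = 0"
      proof
        fix p assume p: "p \<in> P - (\<lambda>\<zeta>. of_real rB * \<zeta>) ` Zs"
        have rp: "of_real rB * (p / of_real rB) = p" using rB_gt1 by simp
        have "p / of_real rB \<notin> Zs"
        proof
          assume "p / of_real rB \<in> Zs"
          hence "of_real rB * (p / of_real rB) \<in> (\<lambda>\<zeta>. of_real rB * \<zeta>) ` Zs" by (rule imageI)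
          thus False using p by (simp only: rp) blast
        qed
        moreover have "cmod (p / of_real rB) = 1" using p P rB_gt1 by (auto simp: norm_divide)
        ultimately have "Lf p = 0"
          using Lf[of p] p unfolding Zs_def mem_Collect_eq rp by auto
        thus "ell (Lf p) p $ j / (p - 1) / p ^ k = 0"
          by (simp add: ell_def vector_matrix_mult_def)
      qed
    qed (auto simp: P_def)
    also have "\<dots> = (\<Sum>\<zeta>\<in>Zs. ell (Lf (of_real rB * \<zeta>)) (of_real rB * \<zeta>) $ j / (of_real rB * \<zeta> - 1) / (of_real rB * \<zeta>) ^ k)"
      using rB_gt1 by (subst sum.reindex) (auto simp: inj_on_def)
    also have "\<dots> = s k / of_real rB ^ k"
      unfolding s_def sum_divide_distrib
    proof (rule sum.cong[OF refl])
      fix \<zeta> assume \<zeta>: "\<zeta> \<in> Zs"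
      have "Lf (of_real rB * \<zeta>) = Bt \<zeta>"
        using tendsto_unique[OF _ Lf Bt[OF \<zeta>]] \<zeta> by (auto simp: P_def)
      thus "ell (Lf (of_real rB * \<zeta>)) (of_real rB * \<zeta>) $ j / (of_real rB * \<zeta> - 1) / (of_real rB * \<zeta>) ^ k =
            ell (Bt \<zeta>) (of_real rB * \<zeta>) $ j / (of_real rB * \<zeta> - 1) / \<zeta> ^ k / of_real rB ^ k"
        by (simp add: power_mult_distrib)
    qed
    finally show ?thesis .
  qed
  moreover have "complex_of_real (real k ^ (mB - 1) / fact (mB - 1)) * (s k / of_real rB ^ k) =
                 of_real (real k ^ (mB - 1) / fact (mB - 1) / rB ^ k) * s k" for k
    by simp
  ultimately show ?thesis
    by (simp only: E_def)
qed

text \<open>Nonnegativity comes from approaching \<open>rB\<close> along the real axis, where the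
  series of \<open>Y\<close> has nonnegative terms. Strictness comes from y = y \<Gamma> + b:
  \<open>b\<close> is nonnegative and nonzero, and irreducibility of \<Gamma> spreads one positive
  entry to all phases.\<close>

lemma ell_pos: "Im (ell Bt1 (of_real rB) $ k) = 0 \<and> Re (ell Bt1 (of_real rB) $ k) > 0"
proof -
  define y where "y = ell Bt1 (of_real rB)"
  have Y_holo: "Y k holomorphic_on ball 0 rB" for k
  proof -
    have "Y k analytic_on {z}" if "z \<in> ball 0 rB" for z
      by (rule Y_analytic, rule analytic_on_subset[OF F_analytic_ball])
         (use that theta_gt_rB in auto)
    thus ?thesis by (meson analytic_imp_holomorphic analytic_on_analytic_at)
  qed
  have path: "filterlim (\<lambda>t. complex_of_real (t * rB)) (at (of_real rB)) (at_left 1)"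
    unfolding filterlim_at
  proof
    show "eventually (\<lambda>t. complex_of_real (t * rB) \<in> UNIV \<and> complex_of_real (t * rB) \<noteq> of_real rB) (at_left 1)"
      using rB_gt1 by (auto simp: eventually_at_filter)
    have "((\<lambda>t. complex_of_real (t * rB)) \<longlongrightarrow> complex_of_real (1 * rB)) (at_left 1)"
      by (intro tendsto_intros)
    thus "((\<lambda>t. complex_of_real (t * rB)) \<longlongrightarrow> of_real rB) (at_left 1)" by simp
  qed
  have y: "Im (y $ k) = 0 \<and> Re (y $ k) \<ge> 0" for k
  proof -
    have "(\<lambda>z. (1 - z / of_real rB) ^ mB * Y k z) \<midarrow>of_real rB\<rightarrow> y $ k"
      unfolding y_def by (rule Y_limit) (use rB_gt1 Bt_lim1 in auto)
    from filterlim_compose[OF this path] have lim: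
      "((\<lambda>t. (1 - complex_of_real (t * rB) / of_real rB) ^ mB * Y k (of_real (t * rB))) \<longlongrightarrow> y $ k) (at_left 1)" .
    have "eventually (\<lambda>t::real. 0 < t \<and> t < 1) (at_left 1)"
      using eventually_at_left_real[of 0 1] by (auto elim: eventually_mono)
    hence ev: "eventually (\<lambda>t. (1 - complex_of_real (t * rB) / of_real rB) ^ mB * Y k (of_real (t * rB)) \<in> \<real>\<^sub>\<ge>\<^sub>0) (at_left 1)"
    proof eventually_elim
      case (elim t)
      \<comment> \<open>The expansion is known near 0; holomorphy on \<open>ball 0 rB\<close> makes
        the series converge up to that radius.\<close>
      have "(\<lambda>n. fps_nth (Abs_fps (\<lambda>n. complex_of_real (lev n k))) n * of_real (t * rB) ^ n) sums Y k (of_real (t * rB))"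
        using elim rB_gt1 Y_holo
        by (intro has_fps_expansion_imp_sums_complex[OF Y_has_fps_expansion, where r = "ereal rB"])
           (auto simp: norm_mult)
      hence 1: "(\<lambda>n. complex_of_real (lev n k * (t * rB) ^ n)) sums Y k (of_real (t * rB))"
        by simp
      have 2: "(\<lambda>n. lev n k * (t * rB) ^ n) sums Re (Y k (of_real (t * rB)))"
        using sums_Re[OF 1] by simp
      have "Y k (of_real (t * rB)) = of_real (Re (Y k (of_real (t * rB))))"
        using 1 sums_of_real[OF 2, where 'a = complex] sums_unique2 by blast
      moreover have "Re (Y k (of_real (t * rB))) \<ge> 0"
        by (rule sums_le[OF _ sums_zero 2]) (use lev_nonneg elim rB_gt1 in auto)
      ultimately have "Y k (of_real (t * rB)) \<in> \<real>\<^sub>\<ge>\<^sub>0"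
        by (metis nonneg_Reals_of_real_iff)
      moreover have "(1 - complex_of_real (t * rB) / of_real rB) ^ mB = of_real ((1 - t) ^ mB)"
        using rB_gt1 by simp
      moreover have "complex_of_real ((1 - t) ^ mB) \<in> \<real>\<^sub>\<ge>\<^sub>0"
        using elim by (simp only: nonneg_Reals_of_real_iff) simp
      ultimately show ?case
        by (simp only: nonneg_Reals_mult_I)
    qed
    have "y $ k \<in> \<real>\<^sub>\<ge>\<^sub>0"
      by (rule Lim_in_closed_set[OF closed_nonneg_Reals_complex ev _ lim]) simp
    thus ?thesis by (simp add: complex_nonneg_Reals_iff)
  qed
  define \<Gamma> where "\<Gamma> = (\<lambda>i j. real_powser_mat A rB $ i $ j / rB)"
  have \<Gamma>_nonneg: "\<Gamma> i j \<ge> 0" for i j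
    unfolding \<Gamma>_def using rB_gt1 theta_gt_rB by (intro divide_nonneg_pos real_powser_mat_nonneg) auto
  define b where "b = (\<lambda>j. \<Sum>i\<in>UNIV. x (L0 i) * Re (Bt1 $ i $ j))"
  have x0: "x (L0 i) > 0" for i by (rule x_pos) (auto simp: mg1_states_def)
  have b_nonneg: "b j \<ge> 0" for j
    unfolding b_def using x0 Bt1_nonneg by (intro sum_nonneg mult_nonneg_nonneg) (auto intro: less_imp_le)
  have eq: "Re (y $ j) = (\<Sum>i\<in>UNIV. Re (y $ i) * \<Gamma> i j) + b j" for j
  proof -
    have "y v* (mat 1 - GammaA A (of_real rB)) = (\<chi> j. complex_of_real (x (L0 j))) v* Bt1"
      unfolding y_def using rB_gt1 theta_gt_rB by (intro ell_solves) auto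
    moreover have "(y v* mat 1) $ j = y $ j" for j
      by (simp add: vector_matrix_mult_def mat_def if_distrib[of "\<lambda>c. _ * c"] cong: if_cong)
    moreover have "GammaA A (of_real rB) $ i $ j = of_real (\<Gamma> i j)" for i j
      unfolding GammaA_def \<Gamma>_def using Astar_of_real[of rB A i j] lt_conv_radius[of rB] theta_gt_rB rB_gt1
      by simp
    ultimately have "y $ j - (\<Sum>i\<in>UNIV. y $ i * of_real (\<Gamma> i j)) = (\<Sum>i\<in>UNIV. of_real (x (L0 i)) * Bt1 $ i $ j)"
      by (simp add: vec_eq_iff vector_matrix_mult_def right_diff_distrib sum_subtractf)
    from arg_cong[OF this, of Re] show ?thesis by (simp add: b_def)
  qed
  have step: "Re (y $ j) > 0" if "Re (y $ i) > 0" "\<Gamma> i j > 0" for i j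
  proof -
    have "0 < Re (y $ i) * \<Gamma> i j" using that by simp
    also have "\<dots> \<le> (\<Sum>i\<in>UNIV. Re (y $ i) * \<Gamma> i j)"
      using y \<Gamma>_nonneg by (intro member_le_sum) auto
    finally show ?thesis using eq[of j] b_nonneg[of j] by linarith
  qed
  obtain i0 j0 where "Bt1 $ i0 $ j0 \<noteq> 0" using Bt1_nz by (auto simp: vec_eq_iff)
  hence "Re (Bt1 $ i0 $ j0) > 0" using Bt1_nonneg[of i0 j0] by (auto simp: complex_eq_iff)
  hence "0 < x (L0 i0) * Re (Bt1 $ i0 $ j0)" using x0 by simp
  also have "\<dots> \<le> b j0"
    unfolding b_def using x0 Bt1_nonneg
    by (intro member_le_sum mult_nonneg_nonneg) (auto intro: less_imp_le)
  also have "b j0 \<le> Re (y $ j0)"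
    using eq[of j0] y \<Gamma>_nonneg by (simp add: sum_nonneg)
  finally have "j0 \<in> {j. Re (y $ j) > 0}" by simp
  moreover have "irreducible_on UNIV \<Gamma>"
    using irreducible_real_powser_mat[of rB] rB_gt1 theta_gt_rB
    by (simp add: irreducible_on_def \<Gamma>_def zero_less_divide_iff)
  ultimately have "k \<in> {j. Re (y $ j) > 0}"
    using irreducible_on_closed_set[of \<Gamma> j0 "{j. Re (y $ j) > 0}"] step by auto
  with y show ?thesis by (simp add: y_def)
qed

end

theorem theorem3p2:
  fixes A :: "nat \<Rightarrow> real^'m::finite^'m"
    and B0 :: "real^'p::finite^'p"
    and B :: "nat \<Rightarrow> real^'m^'p"
    and C0 :: "real^'p^'m"
    and x :: "('p, 'm) mg1_state \<Rightarrow> real"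
    and pi :: "real^'m"
    and theta rB :: real
    and mB :: nat
    and U :: "complex set"
    and F :: "complex \<Rightarrow> complex^'m^'p"
    and Bt :: "complex \<Rightarrow> complex^'m^'p"
  defines "Zs \<equiv> {\<zeta>. cmod \<zeta> = 1 \<and> (\<exists>L. L \<noteq> 0 \<and>
              ((\<lambda>z. \<chi> i j. (1 - z / (complex_of_real rB * \<zeta>)) ^ mB * F z $ i $ j)
                 \<longlongrightarrow> L) (at (complex_of_real rB * \<zeta>)))}"
  defines "xi \<equiv> (\<lambda>k::nat. \<Sum>\<zeta>\<in>Zs.
              (1 / \<zeta> ^ k * (1 / (complex_of_real rB * \<zeta> - 1))) *s
              (((\<chi> j. complex_of_real (x (L0 j))) v* Bt \<zeta>)
                 v* matrix_inv (mat 1 - GammaA A (complex_of_real rB * \<zeta>))))"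
  defines "xbar \<equiv> (\<lambda>(k::nat) (j::'m). \<Sum>i. x (Lk (k + 1 + i) j))"
  \<comment> \<open>nonnegativity of the blocks\<close>
  assumes A_nonneg: "\<And>k i j. A k $ i $ j \<ge> 0"
    and B0_nonneg: "\<And>i j. B0 $ i $ j \<ge> 0"
    and B_nonneg: "\<And>k i j. B k $ i $ j \<ge> 0"
    and C0_nonneg: "\<And>i j. C0 $ i $ j \<ge> 0"
  \<comment> \<open>A is stochastic, the B-rows sum to one, and T is stochastic at level 1\<close>
    and A_stoch: "\<And>i. (\<lambda>k. \<Sum>j\<in>UNIV. A k $ i $ j) sums 1"
    and B_stoch: "\<And>i. (\<lambda>k. \<Sum>j\<in>UNIV. B (Suc k) $ i $ j) sums (1 - (\<Sum>j\<in>UNIV. B0 $ i $ j))"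
    and C0_stoch: "\<And>i. (\<Sum>j\<in>UNIV. C0 $ i $ j) = (\<Sum>j\<in>UNIV. A 0 $ i $ j)"
  \<comment> \<open>pi is the stationary vector of A\<close>
    and pi_stat: "pi v* msum A = pi"
    and pi_norm: "(\<Sum>j\<in>UNIV. pi $ j) = 1"
  \<comment> \<open>x is the stationary probability vector of T\<close>
    and x_nonneg: "\<And>s. s \<in> mg1_states \<Longrightarrow> x s \<ge> 0"
    and x_prob: "(x has_sum 1) mg1_states"
    and x_stat: "\<And>t. t \<in> mg1_states \<Longrightarrow>
                   ((\<lambda>s. x s * mg1_T A B0 B C0 s t) has_sum x t) mg1_states"
  \<comment> \<open>Assumption 1\<close>
    and T_irred: "irreducible_on mg1_states (mg1_T A B0 B C0)"
    and A_irred: "irreducible_on UNIV (\<lambda>i j. msum A $ i $ j)"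
    and drift: "(\<Sum>i\<in>UNIV. pi $ i * (\<Sum>k. real k * (\<Sum>j\<in>UNIV. A k $ i $ j))) < 1"
    and B_mean: "\<And>i. summable (\<lambda>k. real k * (\<Sum>j\<in>UNIV. B k $ i $ j))"
  \<comment> \<open>Assumption 2\<close>
    and rA_gt1: "conv_radius A > 1"
    and rB_def: "conv_radius B = ereal rB"
    and rB_gt1: "rB > 1"
  \<comment> \<open>Assumption 3\<close>
    and theta_gt1: "1 < theta"
    and theta_lt_rA: "ereal theta < conv_radius A"
    and theta_delta: "complex_of_real theta = delta (Astar A (complex_of_real theta))"
  \<comment> \<open>Assumption 4\<close>
    and U_open: "open U"
    and U_disc: "cball 0 rB \<subseteq> U"
    and F_mero: "\<And>i j. (\<lambda>z. F z $ i $ j) meromorphic_on U"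
    and F_ext: "\<And>z. z \<in> ball 0 rB \<Longrightarrow> F z = Bstar B z"
    and mB_pos: "mB \<ge> 1"
    and Bt_lim1: "((\<lambda>z. \<chi> i j. (1 - z / complex_of_real rB) ^ mB * F z $ i $ j)
                    \<longlongrightarrow> Bt 1) (at (complex_of_real rB))"
    and Bt1_nonneg: "\<And>i j. Im (Bt 1 $ i $ j) = 0 \<and> Re (Bt 1 $ i $ j) \<ge> 0"
    and Bt1_nz: "Bt 1 \<noteq> 0"
  \<comment> \<open>Assumption 5\<close>
    and Zs_finite: "finite Zs"
    and Bt_lim: "\<And>\<zeta>. \<zeta> \<in> Zs \<Longrightarrow>
                 ((\<lambda>z. \<chi> i j. (1 - z / (complex_of_real rB * \<zeta>)) ^ mB * F z $ i $ j)
                    \<longlongrightarrow> Bt \<zeta>) (at (complex_of_real rB * \<zeta>))"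
  \<comment> \<open>hypothesis of the theorem\<close>
    and theta_gt_rB: "theta > rB"
  shows "\<exists>\<epsilon>0>0.
     (mB = 1 \<longrightarrow> (\<forall>j. (\<lambda>k. cmod (complex_of_real (xbar k j)
          - complex_of_real (real k ^ (mB - 1) / fact (mB - 1) / rB ^ k) * xi k $ j))
        \<in> O(\<lambda>k. 1 / (rB + \<epsilon>0) ^ k)))
   \<and> (mB \<ge> 2 \<longrightarrow> (\<forall>j. (\<lambda>k. cmod (complex_of_real (xbar k j)
          - complex_of_real (real k ^ (mB - 1) / fact (mB - 1) / rB ^ k) * xi k $ j))
        \<in> O(\<lambda>k. real k ^ (mB - 2) / rB ^ k)))
   \<and> (\<forall>j. Limsup sequentially (\<lambda>k. ereal (Re (xi k $ j))) > 0)
   \<and> (\<forall>k j. Im (xi k $ j) = 0 \<and> Re (xi k $ j) \<ge> 0)"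
proof -
  interpret mg1_chain A pi theta B0 B C0 x rB mB U F "Bt 1"
    by unfold_locales
       (fact A_nonneg A_stoch pi_stat pi_norm A_irred drift theta_gt1 theta_lt_rA theta_delta
         B0_nonneg B_nonneg C0_nonneg x_nonneg x_prob x_stat T_irred rB_def rB_gt1 theta_gt_rB
         U_open U_disc F_mero F_ext mB_pos Bt_lim1 Bt1_nonneg Bt1_nz)+
  have tail_eq: "tail k j = xbar k j" for k j
    by (simp add: tail_def lev_def xbar_def)
  define c where "c = (\<lambda>j \<zeta>. ell (Bt \<zeta>) (of_real rB * \<zeta>) $ j / (of_real rB * \<zeta> - 1))"
  have xi_eq: "xi k $ j = (\<Sum>\<zeta>\<in>Zs. c j \<zeta> / \<zeta> ^ k)" for k j
    by (simp add: xi_def c_def ell_def sum_component mult_ac)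
  have unit: "cmod \<zeta> = 1" if "\<zeta> \<in> Zs" for \<zeta>
    using that by (simp add: Zs_def)
  define Err where "Err = (\<lambda>j k. cmod (complex_of_real (xbar k j)
          - complex_of_real (real k ^ (mB - 1) / fact (mB - 1) / rB ^ k) * xi k $ j))"
  have "\<exists>\<epsilon>>0. (mB = 1 \<longrightarrow> Err j \<in> O(\<lambda>k. 1 / (rB + \<epsilon>) ^ k)) \<and>
                (mB \<ge> 2 \<longrightarrow> Err j \<in> O(\<lambda>k. real k ^ (mB - 2) / rB ^ k))" for j
    using tail_asymp[of Bt j, folded Zs_def, OF Zs_finite Bt_lim]
    by (simp only: Err_def tail_eq xi_eq c_def)
  hence "\<forall>j. \<exists>\<epsilon>. \<epsilon> > 0 \<and> (mB = 1 \<longrightarrow> Err j \<in> O(\<lambda>k. 1 / (rB + \<epsilon>) ^ k)) \<and>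
                (mB \<ge> 2 \<longrightarrow> Err j \<in> O(\<lambda>k. real k ^ (mB - 2) / rB ^ k))"
    by blast
  from choice[OF this] obtain e where e: "\<And>j. e j > 0"
    and e1: "\<And>j. mB = 1 \<Longrightarrow> Err j \<in> O(\<lambda>k. 1 / (rB + e j) ^ k)"
    and e2: "\<And>j. mB \<ge> 2 \<Longrightarrow> Err j \<in> O(\<lambda>k. real k ^ (mB - 2) / rB ^ k)"
    by blast
  \<comment> \<open>There are finitely many phases, and a smaller \<epsilon> only weakens each
    bound.\<close>
  define \<epsilon> where "\<epsilon> = Min (range e)"
  have \<epsilon>: "\<epsilon> > 0" "\<And>j. \<epsilon> \<le> e j"
    using e by (auto simp: \<epsilon>_def)
  have bigo1: "Err j \<in> O(\<lambda>k. 1 / (rB + \<epsilon>) ^ k)" if "mB = 1" for j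
  proof (rule landau_o.big_trans[OF e1[OF that]])
    show "(\<lambda>k. 1 / (rB + e j) ^ k) \<in> O(\<lambda>k. 1 / (rB + \<epsilon>) ^ k)"
      using \<epsilon> e[of j] rB_gt1
      by (intro bigoI[where c = 1] always_eventually) (auto simp: field_simps intro!: power_mono)
  qed
  have nonneg: "Im (xi k $ j) = 0 \<and> Re (xi k $ j) \<ge> 0" for k j
    unfolding xi_eq
  proof (rule almost_periodic_nonneg[OF Zs_finite unit])
    show "xbar k j * rB ^ k * fact (mB - 1) / real k ^ (mB - 1) \<ge> 0" for k
      using tail_nonneg[of k j] rB_gt1 by (simp add: tail_eq)
    have "(\<lambda>k. of_real (xbar k j * rB ^ k * fact (mB - 1) / real k ^ (mB - 1)) - xi k $ j) \<longlonglongrightarrow> 0"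
      by (rule scaled_error_tendsto_0[OF _ mB_pos e e1[unfolded Err_def] e2[unfolded Err_def]]) (use rB_gt1 in auto)
    thus "(\<lambda>k. of_real (xbar k j * rB ^ k * fact (mB - 1) / real k ^ (mB - 1))
            - (\<Sum>\<zeta>\<in>Zs. c j \<zeta> / \<zeta> ^ k)) \<longlonglongrightarrow> 0"
      by (simp only: xi_eq)
  qed
  have "Limsup sequentially (\<lambda>k. ereal (Re (xi k $ j))) > 0" for j
    unfolding xi_eq
  proof (rule almost_periodic_Limsup_pos[OF Zs_finite unit])
    \<comment> \<open>The nonzero limit at \<open>rB\<close> itself supplies the non-oscillating
      term.\<close>
    show "1 \<in> Zs" using Bt_lim1 Bt1_nz by (auto simp: Zs_def)
    show "c j 1 \<noteq> 0" using ell_pos[of j] rB_gt1 by (auto simp: c_def complex_eq_iff)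
    show "Im (\<Sum>\<zeta>\<in>Zs. c j \<zeta> / \<zeta> ^ k) = 0 \<and> Re (\<Sum>\<zeta>\<in>Zs. c j \<zeta> / \<zeta> ^ k) \<ge> 0" for k
      using nonneg[of k j] by (simp only: xi_eq)
  qed
  thus ?thesis
    using \<epsilon>(1) bigo1 e2 nonneg unfolding Err_def by blast
qed

end
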